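(* Let $U_z=\{z:|z|<1\}$ and $U_w=\{w:|w|<1\}$. If a univalent function $f$ of the class $\mathcal B$ does not take in the disk $U_z$ a value $w_0\in U_w$, then $$\operatorname{Re}\frac{S_f(1)}{(f'(1))^2}\ \le\ -\frac34\left(\frac{1-\rho}{1+\rho}\right)^2,\qquad \rho=|w_0| .$$ Here equality holds, for instance, for the Pick function $w=f(z;\rho)$ given by the equation $$\frac{4\rho z}{(1+\rho)^2(1-z)^2}=\frac{w}{(1-w)^2}.$$ This function maps the unit disk $U_z$ conformally and univalently onto the unit disk $U_w$ with the segment $[-1,-\rho]$ removed.
   Context: The class $\mathcal B$ consists of the functions $f$ holomorphic in the unit disk $U_z$ with $f(U_z)\subset U_w$ that have the asymptotic expansion $$f(z)=1+a_1(z-1)+a_2(z-1)^2+a_3(z-1)^3+\angle o((z-1)^3),$$ where $a_1>0$, $\operatorname{Re}(2a_2+a_1(1-a_1))=0$, and $\angle o((z-1)^3)$ denotes a quantity that is $o((z-1)^3)$ as $z\to1$ in every Stolz angle in $U_z$ with vertex at $z=1$. For such $f$ one sets $f'(1)=a_1$ and the boundary Schwarzian derivative at $1$ is $S_f(1)=6\bigl(a_3/a_1-a_2^2/a_1^2\bigr)$. *)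

theory Defs
  imports "HOL-Complex_Analysis.Complex_Analysis" "HOL-Library.Landau_Symbols"
begin

(* The Stolz angle at 1 of half-opening alpha < pi/2.  The usual truncation
   |z - 1| < r is omitted: only limits at the vertex 1 are taken, and near 1 the
   sector lies inside the disk anyway. *)
definition stolz_angle :: "real \<Rightarrow> complex set" where
  "stolz_angle \<alpha> = {z \<in> ball 0 1. \<bar>Arg (1 - z)\<bar> < \<alpha>}"

definition boundary_expansion ::
    "(complex \<Rightarrow> complex) \<Rightarrow> complex \<Rightarrow> complex \<Rightarrow> complex \<Rightarrow> bool" where
  "boundary_expansion f a1 a2 a3 \<longleftrightarrow>
     (\<forall>\<alpha>. 0 < \<alpha> \<and> \<alpha> < pi / 2 \<longrightarrow>
        (\<lambda>z. f z - (1 + a1 * (z - 1) + a2 * (z - 1) ^ 2 + a3 * (z - 1) ^ 3))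
          \<in> o[at 1 within stolz_angle \<alpha>](\<lambda>z. (z - 1) ^ 3))"

definition class_B :: "(complex \<Rightarrow> complex) set" where
  "class_B = {f. f holomorphic_on ball 0 1 \<and> f ` ball 0 1 \<subseteq> ball 0 1 \<and>
     (\<exists>(a1::real) a2 a3. boundary_expansion f (of_real a1) a2 a3 \<and> a1 > 0 \<and>
        Re (2 * a2 + of_real a1 * (1 - of_real a1)) = 0)}"

(* The coefficients are determined by f; see boundary_coeffs_eq below. *)
definition boundary_coeffs :: "(complex \<Rightarrow> complex) \<Rightarrow> complex \<times> complex \<times> complex" where
  "boundary_coeffs f = (THE (a1, a2, a3). boundary_expansion f a1 a2 a3)"

definition boundary_deriv :: "(complex \<Rightarrow> complex) \<Rightarrow> complex" where
  "boundary_deriv f = (case boundary_coeffs f of (a1, a2, a3) \<Rightarrow> a1)"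

definition boundary_schwarzian :: "(complex \<Rightarrow> complex) \<Rightarrow> complex" where
  "boundary_schwarzian f =
     (case boundary_coeffs f of (a1, a2, a3) \<Rightarrow> 6 * (a3 / a1 - a2 ^ 2 / a1 ^ 2))"

definition pick_equation :: "real \<Rightarrow> complex \<Rightarrow> complex \<Rightarrow> bool" where
  "pick_equation \<rho> z w \<longleftrightarrow>
     4 * of_real \<rho> * z / ((1 + of_real \<rho>) ^ 2 * (1 - z) ^ 2) = w / (1 - w) ^ 2"

(* Besides the root w in the disk the equation has, for z ~= 0, the root 1 / w outside it. *)
definition pick_function :: "real \<Rightarrow> complex \<Rightarrow> complex" where
  "pick_function \<rho> z = (THE w. w \<in> ball 0 1 \<and> pick_equation \<rho> z w)"

lemma boundary_expansion_unique:
  assumes "boundary_expansion f a1 a2 a3" "boundary_expansion f b1 b2 b3"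
  shows "a1 = b1 \<and> a2 = b2 \<and> a3 = b3"
proof -
  define F where "F = at 1 within stolz_angle (pi / 4)"
  define r where "r = (\<lambda>t::real. 1 - complex_of_real t)"
  have "filterlim r F (at_right 0)"
    unfolding F_def filterlim_at
  proof
    show "\<forall>\<^sub>F t in at_right 0. r t \<in> stolz_angle (pi / 4) \<and> r t \<noteq> 1"
    proof -
      have "r t \<in> stolz_angle (pi / 4) \<and> r t \<noteq> 1" if "0 < t" "t < 1" for t
      proof -
        have "norm (r t) = \<bar>1 - t\<bar>"
          unfolding r_def by (metis norm_of_real of_real_1 of_real_diff)
        then show ?thesis
          using that by (simp add: stolz_angle_def r_def Arg_of_real)
      qed
      then show ?thesis
        by (auto intro!: eventually_at_rightI[of 0 1])
    qed
    have "(r \<longlongrightarrow> r 0) (at_right 0)"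
      unfolding r_def by (intro tendsto_intros)
    then show "(r \<longlongrightarrow> 1) (at_right 0)"
      by (simp add: r_def)
  qed
  define d1 d2 d3 where "d1 = b1 - a1" and "d2 = b2 - a2" and "d3 = b3 - a3"
  have "(\<lambda>z. f z - (1 + a1 * (z - 1) + a2 * (z - 1) ^ 2 + a3 * (z - 1) ^ 3)) \<in> o[F](\<lambda>z. (z - 1) ^ 3)"
       "(\<lambda>z. f z - (1 + b1 * (z - 1) + b2 * (z - 1) ^ 2 + b3 * (z - 1) ^ 3)) \<in> o[F](\<lambda>z. (z - 1) ^ 3)"
    using assms unfolding boundary_expansion_def F_def by auto
  from sum_in_smallo(2)[OF this]
  have "(\<lambda>z. d1 * (z - 1) + d2 * (z - 1) ^ 2 + d3 * (z - 1) ^ 3) \<in> o[F](\<lambda>z. (z - 1) ^ 3)"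
    by (simp add: d1_def d2_def d3_def algebra_simps)
  from landau_o.small.compose[OF this \<open>filterlim r F (at_right 0)\<close>]
  have "(\<lambda>t. d1 * (r t - 1) + d2 * (r t - 1) ^ 2 + d3 * (r t - 1) ^ 3)
          \<in> o[at_right 0](\<lambda>t. (r t - 1) ^ 3)" .
  then have "((\<lambda>t. (d1 * (r t - 1) + d2 * (r t - 1) ^ 2 + d3 * (r t - 1) ^ 3) / (r t - 1) ^ 3) \<longlongrightarrow> 0)
      (at_right 0)"
    by (rule smalloD_tendsto)
  also have "?this \<longleftrightarrow> ((\<lambda>t. d1 / of_real t ^ 2 - d2 / of_real t + d3) \<longlongrightarrow> 0) (at_right (0::real))"
    by (intro filterlim_cong refl eventually_at_rightI[of 0 1])
       (auto simp: r_def field_simps power2_eq_square power3_eq_cube)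
  finally have L: "((\<lambda>t. d1 / of_real t ^ 2 - d2 / of_real t + d3) \<longlongrightarrow> 0) (at_right (0::real))" .
  have id0: "((\<lambda>t. complex_of_real t) \<longlongrightarrow> 0) (at_right (0::real))"
    using tendsto_of_real[of "\<lambda>t. t" 0 "at_right (0::real)", where ?'a = complex]
    by (simp add: tendsto_ident_at)
  have pos: "\<forall>\<^sub>F t in at_right (0::real). t > 0"
    by (simp add: eventually_at_right_less)
  have "((\<lambda>t. (d1 / of_real t ^ 2 - d2 / of_real t + d3) * of_real t ^ 2
            + d2 * of_real t - d3 * of_real t ^ 2) \<longlongrightarrow> 0 * 0 ^ 2 + d2 * 0 - d3 * 0 ^ 2) (at_right (0::real))"
    by (intro tendsto_intros L id0)
  also have "?this \<longleftrightarrow> ((\<lambda>t. d1) \<longlongrightarrow> 0) (at_right (0::real))"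
    by (intro filterlim_cong eventually_mono[OF pos])
       (auto simp: field_simps power2_eq_square)
  finally have d1: "d1 = 0"
    by (simp add: tendsto_const_iff)
  have "((\<lambda>t. (d1 / of_real t ^ 2 - d2 / of_real t + d3) * of_real t
            - d3 * of_real t) \<longlongrightarrow> 0 * 0 - d3 * 0) (at_right (0::real))"
    by (intro tendsto_intros L id0)
  also have "?this \<longleftrightarrow> ((\<lambda>t. - d2) \<longlongrightarrow> 0) (at_right (0::real))"
    by (intro filterlim_cong eventually_mono[OF pos])
       (auto simp: field_simps power2_eq_square d1)
  finally have d2: "d2 = 0"
    by (simp add: tendsto_const_iff)
  have "d3 = 0"
    using L d1 d2 by (simp add: tendsto_const_iff)
  with d1 d2 show ?thesis
    by (simp add: d1_def d2_def d3_def)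
qed

lemma boundary_coeffs_eq:
  assumes "boundary_expansion f a1 a2 a3"
  shows "boundary_coeffs f = (a1, a2, a3)"
proof -
  have "(case x of (b1, b2, b3) \<Rightarrow> boundary_expansion f b1 b2 b3) \<longleftrightarrow> x = (a1, a2, a3)" for x
    using assms boundary_expansion_unique by (cases x) (simp, blast)
  then show ?thesis
    unfolding boundary_coeffs_def by (intro the_equality) auto
qed

end

theory Submission
  imports Defs "HOL-Computational_Algebra.Fundamental_Theorem_Algebra"
begin

text \<open>
  At an interior point the theorem corresponds to Pick's inequality
  \<open>|f'(z)| (1 - |z|\<^sup>2) / (1 - |f z|\<^sup>2) \<le> 4r / (1 + r)\<^sup>2 = 1 - ((1 - r) / (1 + r))\<^sup>2\<close>, where \<open>r\<close> is
  the pseudohyperbolic distance from \<open>f z\<close> to the omitted value \<open>w\<^sub>0\<close>; it follows from Koebe's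
  quarter theorem applied to \<open>f\<close> followed by a rotated Koebe function. Let \<open>z = 1 - t\<close> and
  \<open>t \<rightarrow> 0\<close>. By the condition on \<open>a\<^sub>2\<close> the left side is \<open>1 + Re S\<^sub>f(1) t\<^sup>2 / 3 + o(t\<^sup>2)\<close>, and the
  right side is \<open>1 - (a\<^sub>1 t (1 - |w\<^sub>0|\<^sup>2) / (2 |1 - w\<^sub>0|\<^sup>2))\<^sup>2 + o(t\<^sup>2)\<close>.

  The quarter theorem is reduced to a Chebyshev estimate. The image of a univalent function fixing
  \<open>0\<close> and omitting \<open>w\<close> contains no circle \<open>|y| = R\<close> with \<open>R \<ge> |w|\<close>, so the set of reciprocals of
  omitted values meets every circle of radius at most \<open>1 / |w|\<close>. The Faber polynomials of \<open>1 / f\<close>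
  grow subexponentially on that set, whereas moving the zeros of a monic polynomial to their moduli
  shows that its maximum over the set is at least \<open>(1 / (4 |w|))\<^sup>n\<close>.
\<close>

section \<open>Koebe's quarter theorem\<close>

lemma exists_norm_ge_on_circle:
  fixes Q :: "complex \<Rightarrow> complex"
  assumes "Q holomorphic_on UNIV"
  shows "\<exists>u. norm u = 1 \<and> norm (Q 0) \<le> norm (Q u)"
proof -
  have cont: "continuous_on A Q" for A
    using assms holomorphic_on_imp_continuous_on holomorphic_on_subset by blast
  have "\<exists>u\<in>sphere 0 1. \<forall>v\<in>sphere 0 1. norm (Q v) \<le> norm (Q u)"
    by (intro continuous_attains_sup continuous_on_norm cont) auto
  then obtain u where u: "norm u = 1" "\<And>v. norm v = 1 \<Longrightarrow> norm (Q v) \<le> norm (Q u)"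
    by auto
  have "norm (Q 0) \<le> norm (Q u)"
    by (rule maximum_modulus_frontier[of Q "ball 0 1"])
       (use u in \<open>auto intro!: cont holomorphic_on_subset[OF assms]\<close>)
  with u show ?thesis by blast
qed

lemma norm_prod_mset_image:
  fixes f :: "'a \<Rightarrow> complex"
  shows "norm (\<Prod>r\<in>#M. f r) = (\<Prod>r\<in>#M. norm (f r))"
  by (induction M) (auto simp: norm_mult)

lemma prod_mset_mono_real:
  fixes f g :: "'a \<Rightarrow> real"
  assumes "\<And>r. 0 \<le> f r" "\<And>r. f r \<le> g r"
  shows "(\<Prod>r\<in>#M. f r) \<le> (\<Prod>r\<in>#M. g r)"
proof -
  have "0 \<le> (\<Prod>r\<in>#M. f r) \<and> (\<Prod>r\<in>#M. f r) \<le> (\<Prod>r\<in>#M. g r)"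
    using assms order_trans[OF assms]
    by (induction M) (auto intro!: mult_mono mult_nonneg_nonneg)
  then show ?thesis ..
qed

text \<open>The substitution \<open>x = (L/4)(1 + u)\<^sup>2 / u\<close> maps the unit circle onto \<open>[0, L]\<close>
  and turns the monic polynomial into a polynomial in \<open>u\<close> with value \<open>(L/4)\<^sup>n\<close> at \<open>0\<close>.\<close>
lemma exists_large_monic_on_segment:
  fixes M :: "real multiset"
  assumes "0 \<le> L"
  shows "\<exists>x\<in>{0..L}. (L / 4) ^ size M \<le> (\<Prod>r\<in>#M. \<bar>x - r\<bar>)"
proof -
  define q where "q = (\<lambda>u r. of_real (L / 4) * (1 + u) ^ 2 - complex_of_real r * u)"
  define Q where "Q = (\<lambda>u. \<Prod>r\<in>#M. q u r)"
  have "Q holomorphic_on UNIV"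
    unfolding Q_def
  proof (induction M)
    case (add r M)
    have "(\<lambda>u. q u r) holomorphic_on UNIV"
      unfolding q_def by (intro holomorphic_intros)
    with add show ?case
      unfolding image_mset_add_mset prod_mset.add_mset by (intro holomorphic_on_mult)
  qed auto
  from exists_norm_ge_on_circle[OF this] obtain u where
    u: "norm u = 1" "norm (Q 0) \<le> norm (Q u)" by blast
  have "Q 0 = of_real (L / 4) ^ size M"
    unfolding Q_def by (induction M) (auto simp: q_def)
  then have Q0: "norm (Q 0) = (L / 4) ^ size M"
    using assms by (simp add: norm_power norm_divide)
  \<comment> \<open>On the unit circle u^2 + 1 = 2 (Re u) u, hence (1 + u)^2 = 2 (1 + Re u) u. Each
    factor of \<open>Q\<close> is therefore u times the real number x - r, and u drops out of the
    norm.\<close>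
  define x where "x = L / 2 * (1 + Re u)"
  have "u * cnj u = 1"
    using u(1) by (simp add: complex_norm_square[symmetric])
  then have "u\<^sup>2 + 1 = (u + cnj u) * u"
    by (simp add: power2_eq_square algebra_simps)
  also have "\<dots> = 2 * of_real (Re u) * u"
    by (simp add: complex_add_cnj)
  finally have u2: "u\<^sup>2 + 1 = 2 * of_real (Re u) * u" .
  have "q u r = of_real (x - r) * u" for r
  proof -
    have "q u r = of_real (L / 4) * ((u\<^sup>2 + 1) + 2 * u) - of_real r * u"
      unfolding q_def by (simp add: power2_eq_square algebra_simps)
    then show ?thesis
      unfolding u2 by (simp add: x_def algebra_simps)
  qed
  then have "norm (Q u) = (\<Prod>r\<in>#M. \<bar>x - r\<bar>)"
    unfolding Q_def norm_prod_mset_image by (simp add: norm_mult u(1) del: of_real_diff)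
  moreover have "x \<in> {0..L}"
    using abs_Re_le_cmod[of u] u(1) assms
    mult_left_mono[of "1 + Re u" 2 "L / 2"]
    by (auto simp: x_def)
  ultimately show ?thesis
    using u(2) Q0 by auto
qed

text \<open>Here \<open>1 / (1 - v f)\<close> is the generating function of the Faber polynomials of \<open>1 / f\<close>.\<close>
lemma fps_geometric_coeff_poly:
  fixes F :: "complex fps"
  assumes "fps_nth F 0 = 0"
  shows "\<exists>p. degree p \<le> n \<and> coeff p n = fps_nth F 1 ^ n \<and>
             (\<forall>v. poly p v = fps_nth (inverse (1 - fps_const v * F)) n)"
proof (intro exI conjI allI)
  \<comment> \<open>The coefficient of order n in the geometric series for 1 / (1 - v F) is a
    polynomial in v, because F^k starts at order k and contributes nothing for k > n. Its leading
    coefficient is that of F^n at order n.\<close>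
  define p where "p = (\<Sum>k\<le>n. monom (fps_nth (F ^ k) n) k)"
  show "degree p \<le> n"
    unfolding p_def by (intro degree_sum_le) (auto intro: degree_monom_le order_trans)
  have "coeff p n = fps_nth (F ^ n) n"
    unfolding p_def by (simp add: coeff_sum coeff_monom if_distrib[of "\<lambda>x. x = _"] sum.delta)
  then show "coeff p n = fps_nth F 1 ^ n"
    by (simp add: startsby_zero_power_nth_same assms)
  fix v
  define X where "X = fps_const v * F"
  have X0: "fps_nth X 0 = 0"
    by (simp add: X_def assms)
  have inv: "inverse (1 - X) * (1 - X) = 1"
    by (rule inverse_mult_eq_1) (simp add: X0)
  \<comment> \<open>The geometric series is cut off after the power n. The exact remainder is a
    multiple of X^(n+1), so it is invisible at order n.\<close>
  have "inverse (1 - X) = inverse (1 - X) * ((1 - X) * (\<Sum>k\<le>n. X ^ k) + X ^ Suc n)"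
    by (subst sum_gp_basic) simp
  also have "\<dots> = (inverse (1 - X) * (1 - X)) * (\<Sum>k\<le>n. X ^ k) + X ^ Suc n * inverse (1 - X)"
    by (simp only: distrib_left mult.assoc mult.commute[of "X ^ Suc n"])
  also have "\<dots> = (\<Sum>k\<le>n. X ^ k) + X ^ Suc n * inverse (1 - X)"
    by (simp only: inv mult_1_left)
  also have "fps_nth \<dots> n = (\<Sum>k\<le>n. fps_nth (X ^ k) n)"
  proof -
    have "fps_nth (X ^ Suc n * inverse (1 - X)) n = 0"
      unfolding fps_mult_nth using startsby_zero_power_prefix[OF X0, of "Suc n"]
      by (intro sum.neutral) (auto simp del: power_Suc)
    then show ?thesis
      by (simp add: fps_sum_nth)
  qed
  also have "\<dots> = poly p v"
    unfolding p_def X_def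
    by (simp add: poly_sum poly_monom power_mult_distrib fps_const_power mult.commute)
  finally show "poly p v = fps_nth (inverse (1 - fps_const v * F)) n"
    by (simp add: X_def)
qed

text \<open>If |w| = R, then w itself is such a point. Otherwise a circle lying entirely in the
  image would wind once around w, while the image is simply connected, being homeomorphic to the
  disk, so that every loop in it has winding number 0 about an omitted point.\<close>

lemma univalent_image_misses_circle:
  assumes f: "f holomorphic_on ball 0 1" "inj_on f (ball 0 1)"
    and w: "w \<notin> f ` ball 0 1" "norm w \<le> R"
  shows "\<exists>y. norm y = R \<and> y \<notin> f ` ball 0 1"
proof (rule ccontr)
  assume "\<not> ?thesis"
  then have sub: "sphere 0 R \<subseteq> f ` ball 0 1" by auto
  with w have "norm w < R" by force
  then have "winding_number (circlepath 0 R) w = 1"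
    by (intro winding_number_circlepath) simp
  have "ball (0::complex) 1 homeomorphic f ` ball 0 1"
    using f by (intro invariance_of_domain_homeomorphic holomorphic_on_imp_continuous_on) auto
  then have sc: "simply_connected (f ` ball 0 1)"
    using homeomorphic_simply_connected_eq convex_imp_simply_connected convex_ball by blast
  have "winding_number (circlepath 0 R) w = 0"
  proof (rule simply_connected_imp_winding_number_zero[OF sc])
    have "0 \<le> R"
      using \<open>norm w < R\<close> norm_ge_zero[of w] by linarith
    then show "path_image (circlepath 0 R) \<subseteq> f ` ball 0 1"
      using sub by simp
  qed (use w in auto)
  with \<open>winding_number (circlepath 0 R) w = 1\<close> show False by simp
qed

lemma power_le_const_imp_le_one:
  fixes y :: real
  assumes "\<And>n. y ^ n \<le> C"
  shows "y \<le> 1"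
proof (rule ccontr)
  assume "\<not> y \<le> 1"
  then obtain n where "C < y ^ n"
    using real_arch_pow[of y C] by auto
  with assms[of n] show False by simp
qed

theorem koebe_quarter:
  assumes f: "f holomorphic_on ball 0 1" "inj_on f (ball 0 1)" "f 0 = 0"
    and w: "w \<notin> f ` ball 0 1"
  shows "norm (deriv f 0) \<le> 4 * norm w"
proof -
  have "0 \<in> f ` ball 0 1"
    using f(3) by (intro image_eqI[of _ _ 0]) auto
  with w have "w \<noteq> 0" by auto
  define L where "L = 1 / norm w"
  have L: "L > 0" using \<open>w \<noteq> 0\<close> by (simp add: L_def)
  define a where "a = deriv f 0"
  have a: "a \<noteq> 0"
    unfolding a_def using f by (intro holomorphic_injective_imp_regular[of f "ball 0 1"]) auto
  have openf: "open (f ` ball 0 1)"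
    using f by (intro open_mapping_thm3) auto
  have contf: "continuous_on (ball 0 1) f"
    using f(1) by (rule holomorphic_on_imp_continuous_on)
  \<comment> \<open>These are the reciprocals of the omitted values, with 0 included as the
    reciprocal of infinity. Stated as v f(z) \<noteq> 1, the condition needs no division, and it
    makes \<open>E\<close> closed.\<close>
  define E where "E = {v. \<forall>z\<in>ball 0 1. v * f z \<noteq> 1}"
  have E_norm: "\<exists>v\<in>E. norm v = x" if "x \<in> {0..L}" for x
  proof (cases "x = 0")
    case False
    with that have "norm w \<le> 1 / x"
      using L by (simp add: L_def field_simps)
    from univalent_image_misses_circle[OF f(1,2) w this] obtain y
      where y: "norm y = 1 / x" "y \<notin> f ` ball 0 1" by blast
    from y(1) False have "y \<noteq> 0" by auto
    have "1 / y \<in> E"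
      unfolding E_def using y(2) \<open>y \<noteq> 0\<close> by auto
    moreover have "norm (1 / y) = x"
      using y(1) by (simp add: norm_divide)
    ultimately show ?thesis by blast
  qed (auto simp: E_def intro!: bexI[of _ 0])
  have "closed E"
  proof -
    have "open ((- {0}) \<inter> inverse -` (f ` ball 0 1))"
      by (intro continuous_open_preimage openf continuous_intros) auto
    also have "(- {0}) \<inter> inverse -` (f ` ball 0 1) = - E"
      proof (intro set_eqI iffI)
      fix v assume "v \<in> - E"
      then obtain z where z: "z \<in> ball 0 1" "v * f z = 1"
        by (auto simp: E_def)
      then have "v \<noteq> 0" "inverse v = f z"
        by (auto intro: inverse_unique)
      with z(1) show "v \<in> (- {0}) \<inter> inverse -` (f ` ball 0 1)" by auto
    next
      fix v assume "v \<in> (- {0}) \<inter> inverse -` (f ` ball 0 1)"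
      then obtain z where "v \<noteq> 0" "inverse v = f z" "z \<in> ball 0 1" by auto
      then show "v \<in> - E"
        unfolding E_def using right_inverse[of v] by auto
    qed
    finally show ?thesis by (simp add: closed_def)
  qed
  define F where "F = fps_expansion f 0"
  have F: "f has_fps_expansion F"
    unfolding F_def using f(1) by (intro has_fps_expansion_fps_expansion[of "ball 0 1"]) auto
  have F0: "fps_nth F 0 = 0" and F1: "fps_nth F 1 = a"
    using fps_nth_fps_expansion[OF F, of 0] fps_nth_fps_expansion[OF F, of 1] f(3)
    by (simp_all add: a_def)
  \<comment> \<open>The polynomial \<open>p\<close> of degree n is at least (|a| L / 4)^n at some
    point of \<open>E\<close> and at most (1 / m) / r^n there, with m independent of n. Letting n
    grow removes the constant 1 / m; afterwards r tends to 1.\<close>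
  have key: "norm a * L / 4 * r \<le> 1" if r: "0 < r" "r < 1" for r :: real
  proof -
    \<comment> \<open>Compactness provides one positive lower bound m for |1 - v f(z)|, uniform in v
      and therefore valid for every n.\<close>
    define K where "K = (E \<inter> cball 0 L) \<times> sphere (0::complex) r"
    have sub: "sphere 0 r \<subseteq> ball (0::complex) 1" "cball 0 r \<subseteq> ball (0::complex) 1"
      using r by auto
    have "compact K"
      unfolding K_def using \<open>closed E\<close> by (intro compact_Times closed_Int_compact) auto
    moreover have "continuous_on K (\<lambda>x. norm (1 - fst x * f (snd x)))"
      unfolding K_def
      by (intro continuous_intros continuous_on_compose2[OF contf]) (use sub in auto)
    moreover have "(0, of_real r) \<in> K"
      unfolding K_def E_def using L r by auto
    ultimately obtain k where k: "k \<in> K" and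
      kmin: "\<And>x. x \<in> K \<Longrightarrow> norm (1 - fst k * f (snd k)) \<le> norm (1 - fst x * f (snd x))"
      using continuous_attains_inf[of K "\<lambda>x. norm (1 - fst x * f (snd x))"] by blast
    define m where "m = norm (1 - fst k * f (snd k))"
    have "m > 0"
      using k sub unfolding m_def K_def E_def by force
    have "(norm a * L / 4 * r) ^ n \<le> 1 / m" for n
    proof -
      from fps_geometric_coeff_poly[OF F0, of n] obtain p where
        p: "degree p \<le> n" "coeff p n = a ^ n"
        "\<And>v. poly p v = fps_nth (inverse (1 - fps_const v * F)) n"
        unfolding F1 by blast
      have deg: "degree p = n"
        using p(1,2) a by (intro antisym le_degree) auto
      then have "p \<noteq> 0" using p(2) a by auto
      from alg_closed_imp_factorization[OF this] obtain M where
        M: "size M = n" "p = smult (a ^ n) (\<Prod>x\<in>#M. [:- x, 1:])"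
        unfolding deg p(2) by blast
      have "poly (\<Prod>x\<in>#M. [:- x, 1:]) v = (\<Prod>x\<in>#M. v - x)" for v :: complex
        by (induction M) (auto simp: algebra_simps)
      then have pv: "norm (poly p v) = norm a ^ n * (\<Prod>x\<in>#M. norm (v - x))" for v
        by (subst M(2)) (simp add: norm_mult norm_power norm_prod_mset_image)
      from exists_large_monic_on_segment[of L "image_mset norm M"] L obtain x where
        x: "x \<in> {0..L}" "(L / 4) ^ n \<le> (\<Prod>r\<in>#M. \<bar>x - norm r\<bar>)"
        by (auto simp: M(1) image_mset.compositionality o_def)
      from E_norm[OF x(1)] obtain v where v: "v \<in> E" "norm v = x" by blast
      have "(norm a * L / 4) ^ n = norm a ^ n * (L / 4) ^ n"
        by (simp add: power_mult_distrib[symmetric])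
      also have "\<dots> \<le> norm a ^ n * (\<Prod>r\<in>#M. \<bar>norm v - norm r\<bar>)"
        using x(2) v(2) by (intro mult_left_mono) auto
      \<comment> \<open>The reverse triangle inequality replaces each root by its modulus. Only |v|
        then matters, so it is enough that \<open>E\<close> meets every circle of radius at most
        \<open>L\<close>, although its points need not lie on a segment.\<close>
      also have "\<dots> \<le> norm (poly p v)"
        unfolding pv by (intro mult_left_mono prod_mset_mono_real norm_triangle_ineq3) auto
      finally have lower: "(norm a * L / 4) ^ n \<le> norm (poly p v)" .
      define G where "G = (\<lambda>z. inverse (1 - v * f z))"
      have "G has_fps_expansion inverse (1 - fps_const v * F)"
        unfolding G_def by (intro fps_expansion_intros F) (simp add: F0)
      then have coeffG: "poly p v = (deriv ^^ n) G 0 / fact n"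
        unfolding p(3) by (rule fps_nth_fps_expansion)
      have holG: "G holomorphic_on ball 0 1"
        unfolding G_def using v(1) by (intro holomorphic_intros f(1)) (auto simp: E_def)
      \<comment> \<open>Cauchy's estimate on the circle of radius r, where |G| \<le> 1 / m.\<close>
      have "norm ((deriv ^^ n) G 0) \<le> fact n * (1 / m) / r ^ n"
      proof (rule Cauchy_inequality)
        show "G holomorphic_on ball 0 r"
          by (rule holomorphic_on_subset[OF holG]) (use r in auto)
        show "continuous_on (cball 0 r) G"
          by (rule continuous_on_subset[OF holomorphic_on_imp_continuous_on[OF holG] sub(2)])
        fix z :: complex assume "norm (0 - z) = r"
        then have "(v, z) \<in> K"
          unfolding K_def using v x(1) by auto
        from kmin[OF this] have "m \<le> norm (1 - v * f z)"
          by (simp add: m_def)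
        from le_imp_inverse_le[OF this \<open>m > 0\<close>] show "norm (G z) \<le> 1 / m"
          unfolding G_def norm_inverse by (simp add: inverse_eq_divide)
      qed fact
      then have "norm (poly p v) \<le> 1 / m / r ^ n"
        unfolding coeffG by (simp add: norm_divide field_simps)
      with lower have "(norm a * L / 4) ^ n \<le> 1 / m / r ^ n" by linarith
      then have "(norm a * L / 4) ^ n * r ^ n \<le> 1 / m"
        using r by (subst (asm) pos_le_divide_eq) auto
      then show ?thesis
        unfolding power_mult_distrib[symmetric] .
    qed
    then show ?thesis by (rule power_le_const_imp_le_one)
  qed
  have "norm a * L / 4 \<le> 1"
  proof (rule tendsto_upperbound)
    have "((\<lambda>r. norm a * L / 4 * r) \<longlongrightarrow> norm a * L / 4 * 1) (at_left 1)"
      by (intro tendsto_intros)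
    then show "((\<lambda>r. norm a * L / 4 * r) \<longlongrightarrow> norm a * L / 4) (at_left 1)"
      by simp
    show "\<forall>\<^sub>F r in at_left 1. norm a * L / 4 * r \<le> 1"
      using key by (auto intro!: eventually_at_leftI[of 0 1])
  qed auto
  then show ?thesis
    using \<open>w \<noteq> 0\<close> by (simp add: L_def a_def field_simps)
qed

section \<open>Pick's inequality\<close>

text \<open>Cross-multiplying turns the equation into (w1 - w2) (1 - c^2 w1 w2) = 0, and the second
  factor cannot vanish since |c w1| and |c w2| are below 1.\<close>

lemma koebe_function_inj:
  fixes c w1 w2 :: complex
  assumes c: "norm c \<le> 1" and w: "norm w1 < 1" "norm w2 < 1"
    and eq: "w1 / (1 - c * w1) ^ 2 = w2 / (1 - c * w2) ^ 2"
  shows "w1 = w2"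
proof -
  have less: "norm (c * w) < 1" if "norm w < 1" for w
    using mult_left_le_one_le[of "norm w" "norm c"] c that by (simp add: norm_mult)
  have nz: "1 - c * w1 \<noteq> 0" "1 - c * w2 \<noteq> 0"
    using less[OF w(1)] less[OF w(2)] by auto
  have "norm ((c * w1) * (c * w2)) < 1 * 1"
    unfolding norm_mult[of "c * w1"] using less[OF w(1)] less[OF w(2)]
    by (intro mult_strict_mono') auto
  then have "1 - (c * w1) * (c * w2) \<noteq> 0" by auto
  moreover have "(w1 - w2) * (1 - (c * w1) * (c * w2)) = 0"
    using eq nz by (simp add: frac_eq_eq) algebra
  ultimately show ?thesis by simp
qed

text \<open>A rotated Koebe function composed with f is again univalent, has the same derivative at
  0 and omits the image of w, so the quarter theorem applies to it.\<close>

lemma pick_at_0: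
  assumes f: "f holomorphic_on ball 0 1" "inj_on f (ball 0 1)" "f 0 = 0"
    and sub: "f ` ball 0 1 \<subseteq> ball 0 1"
    and w: "w \<in> ball 0 1" "w \<notin> f ` ball 0 1"
  shows "norm (deriv f 0) \<le> 4 * norm w / (1 + norm w) ^ 2"
proof -
  have "0 \<in> f ` ball 0 1"
    using f(3) by (intro image_eqI[of _ _ 0]) auto
  with w have "w \<noteq> 0" by auto
  \<comment> \<open>This rotation turns w to the negative axis. There |1 - c w| takes its largest
    possible value 1 + |w|, which makes |k(w)|, and with it the bound, as small as possible.\<close>
  define c where "c = - cnj w / norm w"
  have c: "norm c = 1"
    using \<open>w \<noteq> 0\<close> by (simp add: c_def norm_divide)
  have cw: "c * w = - of_real (norm w)"
    using \<open>w \<noteq> 0\<close> complex_norm_square[of w]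
    by (simp add: c_def field_simps power2_eq_square)
  define k where "k = (\<lambda>w. w / (1 - c * w) ^ 2)"
  have nz: "1 - c * v \<noteq> 0" if "norm v < 1" for v
  proof
    assume "1 - c * v = 0"
    then have "norm (c * v) = 1" by auto
    with that c show False by (simp add: norm_mult)
  qed
  have k_inj: "v1 = v2" if "norm v1 < 1" "norm v2 < 1" "k v1 = k v2" for v1 v2
    using koebe_function_inj[of c v1 v2] that c by (simp add: k_def)
  have fball: "norm (f z) < 1" if "norm z < 1" for z
    using subsetD[OF sub imageI, of z] that by simp
  have "norm (deriv (\<lambda>z. k (f z)) 0) \<le> 4 * norm (k w)"
  proof (rule koebe_quarter)
    show "(\<lambda>z. k (f z)) holomorphic_on ball 0 1"
      unfolding k_def by (intro holomorphic_intros f(1)) (use nz fball in auto)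
    show "inj_on (\<lambda>z. k (f z)) (ball 0 1)"
      using f(2) fball k_inj by (auto simp: inj_on_def)
    show "k (f 0) = 0"
      by (simp add: k_def f(3))
    show "k w \<notin> (\<lambda>z. k (f z)) ` ball 0 1"
    proof
      assume "k w \<in> (\<lambda>z. k (f z)) ` ball 0 1"
      then obtain z where z: "norm z < 1" "k w = k (f z)" by auto
      have "w = f z"
        using w(1) z(1) fball[OF z(1)] by (intro k_inj[OF _ _ z(2)]) simp_all
      then show False
        using w(2) z(1) by simp
    qed
  qed
  moreover have "((\<lambda>z. k (f z)) has_field_derivative deriv f 0) (at 0)"
  proof -
    have "(f has_field_derivative deriv f 0) (at 0)"
      by (rule holomorphic_derivI[OF f(1)]) auto
    then show ?thesis
      unfolding k_def by (auto intro!: derivative_eq_intros simp: f(3))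
  qed
  moreover have "norm (k w) = norm w / (1 + norm w) ^ 2"
  proof -
    have "norm (1 - c * w) = 1 + norm w"
    proof -
      have "1 - c * w = of_real (1 + norm w)"
        unfolding cw by simp
      then show ?thesis
        by (simp only: norm_of_real abs_of_nonneg[OF add_nonneg_nonneg[OF zero_le_one norm_ge_zero]])
    qed
    then show ?thesis
      by (simp add: k_def norm_divide norm_power)
  qed
  ultimately show ?thesis
    by (simp add: DERIV_imp_deriv)
qed

text \<open>Disk automorphisms before and after f move z and f(z) to 0 and reduce the claim to
  \<open>pick_at_0\<close>. Their derivatives supply the factors 1 - |z|^2 and 1 / (1 - |f z|^2),
  and w goes to a point of modulus r.\<close>

lemma pick_interior:
  assumes f: "f holomorphic_on ball 0 1" "inj_on f (ball 0 1)"
    and sub: "f ` ball 0 1 \<subseteq> ball 0 1"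
    and w: "w \<in> ball 0 1" "w \<notin> f ` ball 0 1" and z: "z \<in> ball 0 1"
  defines "r \<equiv> norm ((w - f z) / (1 - cnj (f z) * w))"
  shows "norm (deriv f z) * (1 - norm z ^ 2) \<le> 4 * r / (1 + r) ^ 2 * (1 - norm (f z) ^ 2)"
proof -
  define M where "M = Moebius_function 0"
  define b where "b = f z"
  have b: "norm b < 1" using subsetD[OF sub imageI, of z] z unfolding b_def by simp
  have z': "norm z < 1" using z by simp
  have M_ball: "norm (M a v) < 1" if "norm a < 1" "norm v < 1" for a v
    unfolding M_def using that by (rule Moebius_function_norm_lt_1)
  have M_inv: "M a (M (- a) v) = v" "M (- a) (M a v) = v" if "norm a < 1" "norm v < 1" for a v
    unfolding M_def using that by (auto intro!: Moebius_function_compose)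
  have M_hol: "M a holomorphic_on ball 0 1" if "norm a < 1" for a
    unfolding M_def using that by (rule Moebius_function_holomorphic)
  have fball: "norm (f v) < 1" if "norm v < 1" for v
    using subsetD[OF sub imageI, of v] that by simp
  define F where "F = (\<lambda>v. M b (f (M (- z) v)))"
  have "norm (deriv F 0) \<le> 4 * norm (M b w) / (1 + norm (M b w)) ^ 2"
  proof (rule pick_at_0)
    have "M b \<circ> f \<circ> M (- z) holomorphic_on ball 0 1"
      using M_hol[of b] M_hol[of "- z"] f(1) b z' M_ball fball
      by (intro holomorphic_on_compose_gen[of _ _ _ "ball 0 1"]) auto
    then show "F holomorphic_on ball 0 1"
      by (simp add: F_def o_def)
    show "inj_on F (ball 0 1)"
    proof (rule inj_onI)
      fix u v assume uv: "u \<in> ball 0 1" "v \<in> ball 0 1" "F u = F v"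
      have "f (M (- z) u) = f (M (- z) v)"
        using uv M_inv(2)[OF b] M_ball fball z' unfolding F_def
        by (metis norm_minus_cancel mem_ball_0)
      then have "M (- z) u = M (- z) v"
        using f(2) uv M_ball z' by (auto simp: inj_on_def)
      then show "u = v"
        using M_inv(1)[OF z'] uv by (metis mem_ball_0)
    qed
    show "F 0 = 0"
      by (simp add: F_def M_def Moebius_function_of_zero b_def Moebius_function_eq_zero)
    show "F ` ball 0 1 \<subseteq> ball 0 1"
      using M_ball fball b z' by (auto simp: F_def)
    show "M b w \<in> ball 0 1"
      using M_ball b w by auto
    show "M b w \<notin> F ` ball 0 1"
    proof
      assume "M b w \<in> F ` ball 0 1"
      then obtain v where v: "norm v < 1" "M b w = M b (f (M (- z) v))"
        by (auto simp: F_def)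
      have "M (- z) v \<in> ball 0 1"
        using v M_ball z' by auto
      moreover have "w = f (M (- z) v)"
        using v w M_inv(2)[OF b] M_ball fball z' by (metis norm_minus_cancel mem_ball_0)
      ultimately show False using w(2) by blast
    qed
  qed
  moreover have "norm (M b w) = r"
    by (simp add: M_def Moebius_function_simple r_def b_def)
  moreover have "norm (deriv F 0) = norm (deriv f z) * (1 - norm z ^ 2) / (1 - norm b ^ 2)"
  proof -
    have nb: "1 - cnj b * b = of_real (1 - norm b ^ 2)" "1 - cnj z * z = of_real (1 - norm z ^ 2)"
      by (simp_all only: of_real_diff of_real_1 complex_norm_square mult.commute)
    have pos: "0 < 1 - norm b ^ 2" "0 < 1 - norm z ^ 2"
      using b z' by (simp_all add: abs_square_less_1)
    then have nz: "1 - cnj b * b \<noteq> 0"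
      unfolding nb of_real_eq_0_iff by linarith
    have "(f has_field_derivative deriv f z) (at z)"
      by (rule holomorphic_derivI[OF f(1)]) (use z in auto)
    moreover have Mz: "(M (- z) has_field_derivative of_real (1 - norm z ^ 2)) (at 0)"
      unfolding M_def Moebius_function_simple nb[symmetric]
      by (auto intro!: derivative_eq_intros simp: algebra_simps)
    moreover have "M (- z) 0 = z"
      by (simp add: M_def Moebius_function_of_zero)
    ultimately have inner: "((\<lambda>v. f (M (- z) v)) has_field_derivative deriv f z * of_real (1 - norm z ^ 2)) (at 0)"
      using DERIV_chain2[of f _ "M (- z)" 0] by simp
    have outer: "(M b has_field_derivative 1 / of_real (1 - norm b ^ 2)) (at b)"
    proof -
      have "((\<lambda>v. (v - b) / (1 - cnj b * v)) has_field_derivative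
          ((1 - 0) * (1 - cnj b * b) - (b - b) * (0 - cnj b)) / ((1 - cnj b * b) * (1 - cnj b * b))) (at b)"
        using nz by (intro DERIV_divide DERIV_diff DERIV_const DERIV_ident DERIV_cmult_Id)
      then show ?thesis
        unfolding M_def Moebius_function_simple nb[symmetric] using nz by simp
    qed
    have "(F has_field_derivative
        1 / of_real (1 - norm b ^ 2) * (deriv f z * of_real (1 - norm z ^ 2))) (at 0)"
      unfolding F_def by (rule DERIV_chain2[OF _ inner])
        (use outer in \<open>simp only: \<open>M (- z) 0 = z\<close> b_def\<close>)
    then have "deriv F 0 = 1 / of_real (1 - norm b ^ 2) * (deriv f z * of_real (1 - norm z ^ 2))"
      by (rule DERIV_imp_deriv)
    then show ?thesis
      using pos by (simp add: norm_mult norm_divide del: of_real_diff)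
  qed
  moreover have "0 < 1 - norm b ^ 2"
    using b by (simp add: abs_square_less_1)
  ultimately show ?thesis
    by (simp add: b_def pos_divide_le_eq)
qed

section \<open>The boundary limit\<close>

text \<open>This prepares Cauchy's estimate near the vertex: the radius is proportional to t, so the
  whole disk stays in one fixed angle. For s = 1 - z it gives |Im s| \<le> t / 2 \<le> Re s, hence
  |Arg s| \<le> pi / 4.\<close>

lemma cball_subset_stolz_angle:
  assumes t: "0 < t" "t < 1" and z: "z \<in> cball (1 - of_real t) (t / 2)"
  shows "z \<in> stolz_angle (pi / 3)" "z \<noteq> 1" "norm (z - 1) \<le> 3 / 2 * t"
proof -
  define s where "s = 1 - z"
  have st: "norm (s - of_real t) \<le> t / 2"
  proof -
    have "s - of_real t = 1 - of_real t - z" by (simp add: s_def)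
    then show ?thesis using z by (simp only: mem_cball dist_norm)
  qed
  have Re: "Re s \<ge> t / 2" and Im: "\<bar>Im s\<bar> \<le> t / 2"
    using abs_Re_le_cmod[of "s - of_real t"] abs_Im_le_cmod[of "s - of_real t"] st by auto
  have "\<bar>Arg s\<bar> \<le> pi / 4"
  proof -
    have "Re s > 0" using Re t by linarith
    then have "Arg s = arctan (Im s / Re s)"
      by (rule arg_conv_arctan)
    moreover have "\<bar>Im s / Re s\<bar> \<le> 1"
      using Re Im \<open>Re s > 0\<close> by (simp add: abs_divide)
    then have "arctan (Im s / Re s) \<le> arctan 1" "arctan (- 1) \<le> arctan (Im s / Re s)"
      by (simp_all only: arctan_le_iff abs_le_iff) linarith+
    ultimately show ?thesis
      by (simp add: arctan_minus arctan_one)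
  qed
  then have "\<bar>Arg (1 - z)\<bar> < pi / 3"
    using pi_gt_zero unfolding s_def by linarith
  moreover have "norm z < 1"
  proof -
    have "norm z \<le> norm (1 - complex_of_real t) + norm (z - (1 - of_real t))"
      by (rule norm_triangle_sub)
    also have "norm (1 - complex_of_real t) = 1 - t"
      using t by (metis abs_of_pos diff_gt_0_iff_gt norm_of_real of_real_1 of_real_diff)
    also have "norm (z - (1 - of_real t)) \<le> t / 2"
      using z by (simp only: mem_cball dist_norm norm_minus_commute)
    finally show ?thesis using t by linarith
  qed
  ultimately show "z \<in> stolz_angle (pi / 3)"
    by (simp add: stolz_angle_def)
  show "z \<noteq> 1"
    using Re t by (auto simp: s_def)
  have "norm s \<le> norm (complex_of_real t) + norm (s - of_real t)"
    by (rule norm_triangle_sub)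
  then show "norm (z - 1) \<le> 3 / 2 * t"
    using st t by (simp add: s_def norm_minus_commute)
qed

text \<open>Values along the radius alone do not control the derivative. The remainder is small in a
  whole Stolz angle, so Cauchy's estimate on the disk of radius t / 2 about 1 - t bounds its
  derivative at the cost of one power of t.\<close>

lemma radial_expansion:
  assumes f: "f holomorphic_on ball 0 1" and ex: "boundary_expansion f a1 a2 a3"
  defines "T \<equiv> complex_of_real"
  shows "((\<lambda>t. (f (1 - T t) - (1 - a1 * T t + a2 * T t ^ 2 - a3 * T t ^ 3)) / T t ^ 3) \<longlongrightarrow> 0)
           (at_right 0)" (is ?A)
    and "((\<lambda>t. (deriv f (1 - T t) - (a1 - 2 * a2 * T t + 3 * a3 * T t ^ 2)) / T t ^ 2) \<longlongrightarrow> 0)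
           (at_right 0)" (is ?B)
proof -
  define g where "g = (\<lambda>z. f z - (1 + a1 * (z - 1) + a2 * (z - 1) ^ 2 + a3 * (z - 1) ^ 3))"
  have g_hol: "g holomorphic_on ball 0 1"
    unfolding g_def by (intro holomorphic_intros f)
  have g_small: "g \<in> o[at 1 within stolz_angle (pi / 3)](\<lambda>z. (z - 1) ^ 3)"
    using ex pi_gt_zero unfolding boundary_expansion_def g_def by simp
  have bound: "\<forall>\<^sub>F t in at_right 0. norm (g (1 - T t)) \<le> e * t ^ 3 \<and>
      norm (deriv g (1 - T t)) \<le> e * t ^ 2" if e: "e > 0" for e :: real
  proof -
    \<comment> \<open>Chosen so that Cauchy's bound e' (3t/2)^3 / (t/2) is exactly e t^2.\<close>
    define e' where "e' = 4 / 27 * e"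
    have e': "e' > 0" using e by (simp add: e'_def)
    from landau_o.smallD[OF g_small e'] obtain d where d: "d > 0"
      "\<And>z. z \<in> stolz_angle (pi / 3) \<Longrightarrow> z \<noteq> 1 \<Longrightarrow> dist z 1 < d \<Longrightarrow> norm (g z) \<le> e' * norm (z - 1) ^ 3"
      unfolding eventually_at norm_power by auto
    define d' where "d' = min 1 (d / 2)"
    have "d' > 0" using d by (simp add: d'_def)
    have "norm (g (1 - T t)) \<le> e * t ^ 3 \<and> norm (deriv g (1 - T t)) \<le> e * t ^ 2"
      if t: "0 < t" "t < d'" for t
    proof -
      have t1: "t < 1" "3 / 2 * t < d" using t d by (auto simp: d'_def)
      have gz: "norm (g z) \<le> e' * (3 / 2 * t) ^ 3" if "z \<in> cball (1 - T t) (t / 2)" for z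
      proof -
        note c = cball_subset_stolz_angle[OF t(1) t1(1) that[unfolded T_def]]
        have "norm (g z) \<le> e' * norm (z - 1) ^ 3"
          using c t1 by (intro d(2)) (auto simp: dist_norm)
        also have "\<dots> \<le> e' * (3 / 2 * t) ^ 3"
          using c e' by (intro mult_left_mono power_mono) auto
        finally show ?thesis .
      qed
      have sub: "cball (1 - T t) (t / 2) \<subseteq> ball 0 1"
        using cball_subset_stolz_angle(1)[OF t(1) t1(1)] unfolding T_def stolz_angle_def by blast
      have "norm ((deriv ^^ 1) g (1 - T t)) \<le> fact 1 * (e' * (3 / 2 * t) ^ 3) / (t / 2) ^ 1"
      proof (rule Cauchy_inequality)
        show "g holomorphic_on ball (1 - T t) (t / 2)"
          using sub ball_subset_cball by (intro holomorphic_on_subset[OF g_hol]) blast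
        show "continuous_on (cball (1 - T t) (t / 2)) g"
          using sub by (intro continuous_on_subset[OF holomorphic_on_imp_continuous_on[OF g_hol]])
        show "norm (g x) \<le> e' * (3 / 2 * t) ^ 3" if "norm (1 - T t - x) = t / 2" for x
          using that by (intro gz) (simp add: dist_norm)
        show "0 < t / 2" using t by simp
      qed
      also have "\<dots> = e * t ^ 2"
        using t by (simp add: e'_def power2_eq_square power3_eq_cube)
      finally have "norm (deriv g (1 - T t)) \<le> e * t ^ 2" by simp
      moreover have "norm (g (1 - T t)) \<le> e * t ^ 3"
      proof -
        have "norm (g (1 - T t)) \<le> e' * (3 / 2 * t) ^ 3"
          using t by (intro gz) simp
        also have "\<dots> = 1 / 2 * (e * t ^ 3)"
          by (simp add: e'_def power3_eq_cube)
        also have "\<dots> \<le> e * t ^ 3"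
          using e t by simp
        finally show ?thesis .
      qed
      ultimately show ?thesis by blast
    qed
    then show ?thesis
      using \<open>d' > 0\<close> by (auto intro!: eventually_at_rightI[of 0 d'])
  qed
  have "((\<lambda>t. g (1 - T t) / T t ^ 3) \<longlongrightarrow> 0) (at_right 0)"
  proof (rule tendstoI)
    fix e :: real assume "e > 0"
    then have "e / 2 > 0" by simp
    from bound[OF this] eventually_at_right_less[of 0]
    show "\<forall>\<^sub>F t in at_right 0. dist (g (1 - T t) / T t ^ 3) 0 < e"
    proof eventually_elim
      case (elim t)
      have "norm (g (1 - T t) / T t ^ 3) \<le> e / 2"
        using elim by (simp add: T_def norm_divide norm_power pos_divide_le_eq)
      then show ?case using \<open>e > 0\<close> by (simp only: dist_norm diff_zero)
    qed
  qed
  moreover have "g (1 - T t) = f (1 - T t) - (1 - a1 * T t + a2 * T t ^ 2 - a3 * T t ^ 3)" for t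
    by (simp add: g_def power2_eq_square power3_eq_cube)
  ultimately show ?A
    by simp
  have "((\<lambda>t. deriv g (1 - T t) / T t ^ 2) \<longlongrightarrow> 0) (at_right 0)"
  proof (rule tendstoI)
    fix e :: real assume "e > 0"
    then have "e / 2 > 0" by simp
    from bound[OF this] eventually_at_right_less[of 0]
    show "\<forall>\<^sub>F t in at_right 0. dist (deriv g (1 - T t) / T t ^ 2) 0 < e"
    proof eventually_elim
      case (elim t)
      have "norm (deriv g (1 - T t) / T t ^ 2) \<le> e / 2"
        using elim by (simp add: T_def norm_divide norm_power pos_divide_le_eq)
      then show ?case using \<open>e > 0\<close> by (simp only: dist_norm diff_zero)
    qed
  qed
  moreover have "\<forall>\<^sub>F t in at_right 0. deriv g (1 - T t) / T t ^ 2 =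
      (deriv f (1 - T t) - (a1 - 2 * a2 * T t + 3 * a3 * T t ^ 2)) / T t ^ 2"
  proof -
    have "deriv g (1 - T t) = deriv f (1 - T t) - (a1 - 2 * a2 * T t + 3 * a3 * T t ^ 2)"
      if "0 < t" "t < 1" for t
    proof (rule DERIV_imp_deriv)
      have "1 - T t \<in> ball 0 1"
        using cball_subset_stolz_angle(1)[of t "1 - T t"] that
        by (simp add: T_def stolz_angle_def)
      then have "(f has_field_derivative deriv f (1 - T t)) (at (1 - T t))"
        by (intro holomorphic_derivI[OF f]) auto
      then show "(g has_field_derivative deriv f (1 - T t) - (a1 - 2 * a2 * T t + 3 * a3 * T t ^ 2))
          (at (1 - T t))"
        unfolding g_def
        by (auto intro!: derivative_eq_intros simp: algebra_simps)
    qed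
    then show ?thesis
      by (auto intro!: eventually_at_rightI[of 0 1])
  qed
  ultimately show ?B
    by (blast intro: Lim_transform_eventually)
qed

section \<open>Pick's inequality expanded along the radius\<close>

lemma one_minus_pseudohyperbolic_sq:
  assumes "1 - cnj b * w \<noteq> 0"
  shows "1 - norm ((w - b) / (1 - cnj b * w)) ^ 2 =
     (1 - norm w ^ 2) * (1 - norm b ^ 2) / norm (1 - cnj b * w) ^ 2"
proof -
  have "norm (1 - cnj b * w) ^ 2 - norm (w - b) ^ 2 = (1 - norm w ^ 2) * (1 - norm b ^ 2)"
    unfolding cmod_power2 by (simp add: power2_eq_square algebra_simps)
  then show ?thesis
    using assms by (simp add: norm_divide power_divide field_simps)
qed

text \<open>Pick's inequality at 1 - t is squared and expanded in t. The remainders are carried as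
  convergent functions rather than as Landau terms, so the expansions are exact identities. After
  the constant and linear terms cancel, division by t^2 and the limit give the bound.\<close>

lemma schwarzian_bound:
  fixes A :: real
  assumes f: "f holomorphic_on ball 0 1" "inj_on f (ball 0 1)" "f ` ball 0 1 \<subseteq> ball 0 1"
    and ex: "boundary_expansion f (of_real A) a2 a3" and A: "A > 0"
    and curv: "Re (2 * a2 + of_real A * (1 - of_real A)) = 0"
    and w: "w \<in> ball 0 1" "w \<notin> f ` ball 0 1"
  shows "Re (6 * (a3 / of_real A - a2 ^ 2 / of_real A ^ 2) / of_real A ^ 2)
           \<le> - (3 / 4) * ((1 - norm w) / (1 + norm w)) ^ 2"
proof -
  define T where "T = complex_of_real"
  define p q where "p = Re a2" and "q = Im a2"
  have p: "2 * p = A\<^sup>2 - A"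
    using curv by (simp add: p_def power2_eq_square algebra_simps)
  define r where "r = (\<lambda>t. 1 - T t)"
  \<comment> \<open>\<open>U\<close> and \<open>D\<close> are the exact third-order and second-order
    remainder quotients of f and its derivative; they tend to a3 and 3 a3.\<close>
  define U where "U = (\<lambda>t. (1 - f (r t) - A * T t + a2 * T t ^ 2) / T t ^ 3)"
  define D where "D = (\<lambda>t. (deriv f (r t) - A + 2 * a2 * T t) / T t ^ 2)"
  have pos: "\<forall>\<^sub>F t in at_right (0::real). 0 < t \<and> t < 1"
    by (auto intro!: eventually_at_rightI[of 0 1])
  have U: "(U \<longlongrightarrow> a3) (at_right 0)"
  proof -
    have "((\<lambda>t. a3 - (f (1 - T t) - (1 - of_real A * T t + a2 * T t ^ 2 - a3 * T t ^ 3)) / T t ^ 3)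
        \<longlongrightarrow> a3 - 0) (at_right 0)"
      using radial_expansion(1)[OF f(1) ex] unfolding T_def by (intro tendsto_diff tendsto_const)
    moreover have "\<forall>\<^sub>F t in at_right 0.
        a3 - (f (1 - T t) - (1 - of_real A * T t + a2 * T t ^ 2 - a3 * T t ^ 3)) / T t ^ 3 = U t"
      using pos by eventually_elim (simp add: U_def r_def T_def field_simps)
    ultimately show ?thesis
      by (auto intro: Lim_transform_eventually)
  qed
  have D: "(D \<longlongrightarrow> 3 * a3) (at_right 0)"
  proof -
    have "((\<lambda>t. 3 * a3 + (deriv f (1 - T t) - (of_real A - 2 * a2 * T t + 3 * a3 * T t ^ 2)) / T t ^ 2)
        \<longlongrightarrow> 3 * a3 + 0) (at_right 0)"
      using radial_expansion(2)[OF f(1) ex] unfolding T_def by (intro tendsto_add tendsto_const)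
    moreover have "\<forall>\<^sub>F t in at_right 0.
        3 * a3 + (deriv f (1 - T t) - (of_real A - 2 * a2 * T t + 3 * a3 * T t ^ 2)) / T t ^ 2 = D t"
      using pos by eventually_elim (simp add: D_def r_def T_def field_simps)
    ultimately show ?thesis
      by (auto intro: Lim_transform_eventually)
  qed
  define X Y V W where "X = (\<lambda>t. Re (U t))" and "Y = (\<lambda>t. Im (U t))"
    and "V = (\<lambda>t. Re (D t))" and "W = (\<lambda>t. Im (D t))"
  define s m where "s = Re a3" and "m = Im a3"
  have lims: "(X \<longlongrightarrow> s) (at_right 0)" "(Y \<longlongrightarrow> m) (at_right 0)"
      "(V \<longlongrightarrow> 3 * s) (at_right 0)" "(W \<longlongrightarrow> 3 * m) (at_right 0)"
    using tendsto_Re[OF U] tendsto_Im[OF U] tendsto_Re[OF D] tendsto_Im[OF D]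
    by (simp_all add: X_def Y_def V_def W_def s_def m_def)
  have id: "((\<lambda>t::real. t) \<longlongrightarrow> 0) (at_right 0)"
    by (rule tendsto_ident_at)
  \<comment> \<open>For t > 0, \<open>t * P t\<close> will be 1 - |f(1 - t)|^2 and
    \<open>H t\<close> will be the squared modulus of the derivative. \<open>P2\<close> and
    \<open>H2\<close> absorb everything from t^2 on.\<close>
  define P2 where "P2 = (\<lambda>t. 2 * X t - (- 2 * A * p + t * (p\<^sup>2 + 2 * A * X t) - 2 * t\<^sup>2 * p * X t
      + t ^ 3 * (X t)\<^sup>2) - t * (- q + t * Y t)\<^sup>2)"
  define H2 where "H2 = (\<lambda>t. 4 * p\<^sup>2 + 2 * A * V t - 4 * p * t * V t + t\<^sup>2 * (V t)\<^sup>2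
      + (- 2 * q + W t * t)\<^sup>2)"
  define P where "P = (\<lambda>t. 2 * A - (2 * p + A\<^sup>2) * t + P2 t * t\<^sup>2)"
  define H where "H = (\<lambda>t. A\<^sup>2 - 4 * A * p * t + H2 t * t\<^sup>2)"
  have P2: "(P2 \<longlongrightarrow> 2 * s - (- 2 * A * p + 0 * (p\<^sup>2 + 2 * A * s) - 2 * 0\<^sup>2 * p * s
      + 0 ^ 3 * s\<^sup>2) - 0 * (- q + 0 * m)\<^sup>2) (at_right 0)"
    unfolding P2_def by (intro tendsto_intros lims id)
  then have P2: "(P2 \<longlongrightarrow> 2 * s + 2 * A * p) (at_right 0)" by simp
  have H2: "(H2 \<longlongrightarrow> 4 * p\<^sup>2 + 2 * A * (3 * s) - 4 * p * 0 * (3 * s) + 0\<^sup>2 * (3 * s)\<^sup>2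
      + (- 2 * q + 3 * m * 0)\<^sup>2) (at_right 0)"
    unfolding H2_def by (intro tendsto_intros lims id)
  then have H2: "(H2 \<longlongrightarrow> 4 * p\<^sup>2 + 6 * A * s + 4 * q\<^sup>2) (at_right 0)" by (simp add: mult.assoc)
  have P: "(P \<longlongrightarrow> 2 * A) (at_right 0)"
  proof -
    have "(P \<longlongrightarrow> 2 * A - (2 * p + A\<^sup>2) * 0 + (2 * s + 2 * A * p) * 0\<^sup>2) (at_right 0)"
      unfolding P_def by (intro tendsto_intros P2 id)
    then show ?thesis by simp
  qed
  have f_eq: "f (r t) = 1 - (A * T t - a2 * T t ^ 2 + U t * T t ^ 3)" if "0 < t" for t
    using that by (simp add: U_def T_def)
  have one_minus_f: "1 - norm (f (r t)) ^ 2 = t * P t" if "0 < t" for t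
  proof -
    have "Re (T t ^ 3) = t ^ 3" "Im (T t ^ 3) = 0" "Re (T t ^ 2) = t\<^sup>2" "Im (T t ^ 2) = 0"
      unfolding T_def of_real_power[symmetric] by simp_all
    then have re: "Re (f (r t)) = 1 - (A * t - p * t\<^sup>2 + X t * t ^ 3)"
      and im: "Im (f (r t)) = q * t\<^sup>2 - Y t * t ^ 3"
      unfolding f_eq[OF that] by (simp_all add: p_def q_def X_def Y_def T_def)
    show ?thesis
      unfolding cmod_power2 re im P_def P2_def by algebra
  qed
  have H_eq: "norm (deriv f (r t)) ^ 2 = H t" if "0 < t" for t
  proof -
    have "deriv f (r t) = A - 2 * a2 * T t + D t * T t ^ 2"
      using that by (simp add: D_def T_def)
    moreover have "Re (T t ^ 2) = t\<^sup>2" "Im (T t ^ 2) = 0"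
      unfolding T_def of_real_power[symmetric] by simp_all
    ultimately have re: "Re (deriv f (r t)) = A - 2 * p * t + V t * t\<^sup>2"
      and im: "Im (deriv f (r t)) = - 2 * q * t + W t * t\<^sup>2"
      by (simp_all add: p_def q_def V_def W_def T_def)
    show ?thesis
      unfolding cmod_power2 re im H_def H2_def by algebra
  qed
  define N where "N = (\<lambda>t. (2 * p + A\<^sup>2)\<^sup>2 + 4 * A * P2 t - 2 * (2 * p + A\<^sup>2) * P2 t * t + (P2 t)\<^sup>2 * t\<^sup>2
      - A\<^sup>2 - 16 * A * p + 4 * A * p * t - H2 t * (2 - t)\<^sup>2)"
  \<comment> \<open>The linear coefficients differ by 4 A (2 p - A^2 + A), which is zero precisely
    by the condition on a2.\<close>
  have N_eq: "(P t)\<^sup>2 - H t * (2 - t)\<^sup>2 = N t * t\<^sup>2" for t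
    using p unfolding P_def H_def N_def by algebra
  \<comment> \<open>This is the real part of the Schwarzian at 1 divided by 6.\<close>
  define \<sigma> where "\<sigma> = s / A - (p\<^sup>2 - q\<^sup>2) / A\<^sup>2"
  have N: "(N \<longlongrightarrow> - 16 * A\<^sup>2 * \<sigma>) (at_right 0)"
  proof -
    have "(N \<longlongrightarrow> (2 * p + A\<^sup>2)\<^sup>2 + 4 * A * (2 * s + 2 * A * p) - 2 * (2 * p + A\<^sup>2) * (2 * s + 2 * A * p) * 0
        + (2 * s + 2 * A * p)\<^sup>2 * 0\<^sup>2 - A\<^sup>2 - 16 * A * p + 4 * A * p * 0
        - (4 * p\<^sup>2 + 6 * A * s + 4 * q\<^sup>2) * (2 - 0)\<^sup>2) (at_right 0)" (is "(_ \<longlongrightarrow> ?l) _")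
      unfolding N_def by (intro tendsto_intros P2 H2 id)
    moreover have "?l = - 16 * (A * s - (p\<^sup>2 - q\<^sup>2))"
      using p by simp algebra
    moreover have "A * s - (p\<^sup>2 - q\<^sup>2) = A\<^sup>2 * \<sigma>"
      using A by (simp add: \<sigma>_def field_simps power2_eq_square)
    ultimately show ?thesis by (simp only: mult.assoc)
  qed
  \<comment> \<open>\<open>t * \<mu> t = (1 - r\<^sup>2) / 4\<close> bounds \<open>(1 - r) / (1 + r)\<close> from below, \<open>r\<close> being the
    pseudohyperbolic distance from \<open>f (1 - t)\<close> to \<open>w\<close>\<close>
  define \<mu> where "\<mu> = (\<lambda>t. (1 - norm w ^ 2) * P t / (4 * norm (1 - cnj (f (r t)) * w) ^ 2))"
  define \<xi> where "\<xi> = (1 - norm w ^ 2) / norm (1 - w) ^ 2"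
  have w1: "norm w < 1" using w by simp
  have \<mu>: "(\<mu> \<longlongrightarrow> A * \<xi> / 2) (at_right 0)"
  proof -
    have T0: "(T \<longlongrightarrow> 0) (at_right 0)"
      unfolding T_def using tendsto_of_real[OF id, where ?'a = complex] by simp
    have "((\<lambda>t. 1 - (A * T t - a2 * T t ^ 2 + U t * T t ^ 3)) \<longlongrightarrow> 1 - (of_real A * 0 - a2 * 0 ^ 2 + a3 * 0 ^ 3))
        (at_right 0)"
      by (intro tendsto_intros T0 U)
    then have "((\<lambda>t. 1 - (A * T t - a2 * T t ^ 2 + U t * T t ^ 3)) \<longlongrightarrow> 1) (at_right 0)"
      by simp
    moreover have "\<forall>\<^sub>F t in at_right 0. 1 - (A * T t - a2 * T t ^ 2 + U t * T t ^ 3) = f (r t)"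
      using pos by eventually_elim (simp add: f_eq)
    ultimately have "((\<lambda>t. f (r t)) \<longlongrightarrow> 1) (at_right 0)"
      by (rule Lim_transform_eventually)
    then have "(\<mu> \<longlongrightarrow> (1 - norm w ^ 2) * (2 * A) / (4 * norm (1 - cnj 1 * w) ^ 2)) (at_right 0)"
      unfolding \<mu>_def using w1 by (intro tendsto_intros P) auto
    moreover have "norm (1 - w) > 0" using w1 by auto
    then have "(1 - norm w ^ 2) * (2 * A) / (4 * norm (1 - cnj 1 * w) ^ 2) = A * \<xi> / 2"
      by (simp add: \<xi>_def divide_simps)
    ultimately show ?thesis by (simp only:)
  qed
  have ineq: "(P t * \<mu> t)\<^sup>2 * (2 - (t * \<mu> t)\<^sup>2) \<le> N t" if t: "0 < t" "t < 1" for t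
  proof -
    have nr: "norm (r t) = 1 - t"
      using t unfolding r_def T_def
      by (metis abs_of_pos diff_gt_0_iff_gt norm_of_real of_real_1 of_real_diff)
    then have rt: "r t \<in> ball 0 1" using t by simp
    define b where "b = f (r t)"
    have b: "norm b < 1"
      using subsetD[OF f(3) imageI[OF rt]] by (simp add: b_def)
    define \<rho> where "\<rho> = norm ((w - b) / (1 - cnj b * w))"
    have "norm (cnj b * w) < 1"
      using mult_strict_mono'[OF b w1] by (simp add: norm_mult)
    then have nz: "1 - cnj b * w \<noteq> 0" by auto
    define g where "g = (1 - \<rho>\<^sup>2) / 4"
    have g: "g = t * \<mu> t"
      unfolding g_def \<rho>_def one_minus_pseudohyperbolic_sq[OF nz] \<mu>_def
      using one_minus_f[OF t(1)] by (simp add: b_def mult_ac)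
    have Ppos: "P t > 0"
      using one_minus_f[OF t(1)] b t by (simp add: b_def) (metis abs_norm_cancel
        abs_square_less_1 diff_gt_0_iff_gt zero_less_mult_pos)
    have "\<mu> t \<ge> 0"
      using w1 Ppos by (simp add: \<mu>_def abs_square_le_1)
    then have "g \<ge> 0" using g t by simp
    have \<rho>0: "\<rho> \<ge> 0" by (simp add: \<rho>_def)
    then have "\<rho> \<le> 1"
      using \<open>g \<ge> 0\<close> by (simp add: g_def abs_square_le_1)
    \<comment> \<open>Pick's factor is 1 - y^2. It is weakened to 1 - g^2 because g involves only
      squared norms and so has an explicit expansion. Nothing is lost in the limit: g tends to 0,
      \<rho> tends to 1, and both g and y behave like (1 - \<rho>) / 2.\<close>
    define y where "y = (1 - \<rho>) / (1 + \<rho>)"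
    have "g \<le> y" "y \<le> 1" "0 \<le> y"
    proof -
      have "y - g = (1 - \<rho>) * (4 - (1 + \<rho>)\<^sup>2) / (4 * (1 + \<rho>))"
        using \<rho>0 by (simp add: y_def g_def field_simps power2_eq_square)
      moreover have "(1 + \<rho>)\<^sup>2 \<le> 2\<^sup>2"
        using \<rho>0 \<open>\<rho> \<le> 1\<close> by (intro power_mono) auto
      then have "0 \<le> (1 - \<rho>) * (4 - (1 + \<rho>)\<^sup>2) / (4 * (1 + \<rho>))"
        using \<rho>0 \<open>\<rho> \<le> 1\<close> by (intro divide_nonneg_nonneg mult_nonneg_nonneg) auto
      ultimately show "g \<le> y"
        by linarith
      show "y \<le> 1" "0 \<le> y"
        using \<rho>0 \<open>\<rho> \<le> 1\<close> by (simp_all add: y_def)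
    qed
    then have gy: "g\<^sup>2 \<le> y\<^sup>2" "y\<^sup>2 \<le> 1"
      using \<open>g \<ge> 0\<close> by (simp_all add: power_mono abs_square_le_1)
    have bound_y: "4 * \<rho> / (1 + \<rho>)\<^sup>2 = 1 - y\<^sup>2"
      using \<rho>0 by (simp add: y_def divide_simps) algebra
    have "1 - (1 - t)\<^sup>2 = t * (2 - t)" by algebra
    with pick_interior[OF f w rt]
    have "norm (deriv f (r t)) * (t * (2 - t)) \<le> (1 - y\<^sup>2) * (t * P t)"
      unfolding nr \<rho>_def[symmetric] b_def[symmetric] one_minus_f[OF t(1), folded b_def] bound_y
      by (simp only:)
    then have "t * (norm (deriv f (r t)) * (2 - t)) \<le> t * ((1 - y\<^sup>2) * P t)"
      by (simp only: mult.assoc mult.left_commute)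
    then have "norm (deriv f (r t)) * (2 - t) \<le> (1 - y\<^sup>2) * P t"
      using t by simp
    also have "\<dots> \<le> (1 - g\<^sup>2) * P t"
      using gy Ppos by (intro mult_right_mono) auto
    finally have "(norm (deriv f (r t)) * (2 - t))\<^sup>2 \<le> ((1 - g\<^sup>2) * P t)\<^sup>2"
      using t by (intro power_mono) auto
    then have "H t * (2 - t)\<^sup>2 \<le> (1 - g\<^sup>2)\<^sup>2 * (P t)\<^sup>2"
      by (simp only: power_mult_distrib H_eq[OF t(1)])
    then have "(P t)\<^sup>2 * (g\<^sup>2 * (2 - g\<^sup>2)) \<le> N t * t\<^sup>2"
      unfolding N_eq[symmetric] by (simp add: power2_eq_square algebra_simps)
    then have "((P t * \<mu> t)\<^sup>2 * (2 - (t * \<mu> t)\<^sup>2)) * t\<^sup>2 \<le> N t * t\<^sup>2"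
      by (simp add: g power_mult_distrib mult_ac)
    then show ?thesis
      using t by simp
  qed
  have "(2 * A * (A * \<xi> / 2))\<^sup>2 * (2 - (0 * (A * \<xi> / 2))\<^sup>2) \<le> - 16 * A\<^sup>2 * \<sigma>"
  proof (rule tendsto_le)
    show "((\<lambda>t. (P t * \<mu> t)\<^sup>2 * (2 - (t * \<mu> t)\<^sup>2)) \<longlongrightarrow>
        (2 * A * (A * \<xi> / 2))\<^sup>2 * (2 - (0 * (A * \<xi> / 2))\<^sup>2)) (at_right 0)"
      by (intro tendsto_intros P \<mu> id)
    show "\<forall>\<^sub>F t in at_right 0. (P t * \<mu> t)\<^sup>2 * (2 - (t * \<mu> t)\<^sup>2) \<le> N t"
      using pos by eventually_elim (rule ineq, auto)
  qed (use N in auto)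
  \<comment> \<open>The limit inequality reads 2 A^4 \<xi>^2 \<le> -16 A^2 \<sigma>. The constant
    3/4 of the theorem is the 6 of the Schwarzian over the 8 that remains here.\<close>
  then have "A\<^sup>2 * (A\<^sup>2 * \<xi>\<^sup>2) \<le> A\<^sup>2 * (- 8 * \<sigma>)"
    by (simp add: power_mult_distrib power_divide) (simp add: power2_eq_square algebra_simps)
  then have "A\<^sup>2 * \<xi>\<^sup>2 \<le> - 8 * \<sigma>"
    by (rule mult_left_le_imp_le) (use A in simp)
  then have "6 * \<sigma> / A\<^sup>2 \<le> - (3 / 4) * \<xi>\<^sup>2"
    using A by (simp add: field_simps)
  moreover have "Re (6 * (a3 / of_real A - a2 ^ 2 / of_real A ^ 2) / of_real A ^ 2) = 6 * \<sigma> / A\<^sup>2"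
    unfolding of_real_power[symmetric] \<sigma>_def
    by (simp add: s_def p_def q_def Re_divide_of_real power2_eq_square)
  \<comment> \<open>\<open>\<xi>\<close> is the Poisson kernel of w at the boundary point 1. For
    given |w| it is smallest at w = -|w|, opposite to that point.\<close>
  moreover have "((1 - norm w) / (1 + norm w))\<^sup>2 \<le> \<xi>\<^sup>2"
  proof (rule power_mono)
    have "norm (1 - w) \<le> 1 + norm w"
      using norm_triangle_ineq4[of 1 w] by simp
    then have "norm (1 - w) ^ 2 \<le> (1 + norm w) ^ 2"
      by (intro power_mono) auto
    moreover have "1 - norm w ^ 2 \<ge> 0" "norm (1 - w) ^ 2 > 0"
      using w1 by (auto simp: abs_square_le_1)
    ultimately have "(1 - norm w ^ 2) / (1 + norm w) ^ 2 \<le> \<xi>"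
      unfolding \<xi>_def by (intro divide_left_mono mult_pos_pos) auto
    moreover have "(1 - norm w ^ 2) / (1 + norm w) ^ 2 = (1 - norm w) / (1 + norm w)"
    proof -
      have "1 + norm w \<noteq> 0"
        using norm_ge_zero[of w] by linarith
      then show ?thesis
        by (simp add: divide_simps) (simp add: power2_eq_square algebra_simps)
    qed
    ultimately show "(1 - norm w) / (1 + norm w) \<le> \<xi>" by simp
  qed (use w1 in auto)
  ultimately show ?thesis by linarith
qed

section \<open>The Pick function\<close>

lemma half_plane_square_real:
  assumes "Re \<zeta> > 0" "\<zeta> ^ 2 = of_real x"
  shows "x > 0"
proof -
  have "Re (\<zeta> ^ 2) = x" "Im (\<zeta> ^ 2) = 0"
    using assms(2) by simp_all
  then have "Im \<zeta> = 0" "x = (Re \<zeta>)\<^sup>2 - (Im \<zeta>)\<^sup>2"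
    using assms(1) by (auto simp: power2_eq_square)
  then show ?thesis using assms(1) by simp
qed

lemma Re_cayley_pos:
  fixes z :: complex
  assumes "norm z < 1"
  shows "Re ((1 + z) / (1 - z)) > 0"
proof -
  have "Re ((1 + z) / (1 - z)) = (1 - norm z ^ 2) / norm (1 - z) ^ 2"
    unfolding cmod_power2 Re_divide by (simp add: power2_eq_square algebra_simps)
  moreover have "1 - norm z ^ 2 > 0" "z \<noteq> 1"
    using assms by (auto simp: abs_square_less_1)
  ultimately show ?thesis by simp
qed

lemma norm_inverse_cayley_less_1:
  fixes s :: complex
  assumes "Re s > 0"
  shows "norm ((s - 1) / (s + 1)) < 1"
proof -
  have "norm (s - 1) ^ 2 < norm (s + 1) ^ 2"
    unfolding cmod_power2 using assms by (simp add: power2_eq_square algebra_simps)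
  then have "norm (s - 1) < norm (s + 1)"
    by (rule power_less_imp_less_base) simp
  moreover from this have "norm (s + 1) > 0"
    using norm_ge_zero[of "s - 1"] by linarith
  ultimately show ?thesis
    by (simp add: norm_divide)
qed

lemma koebe_function_cayley:
  fixes z :: complex
  assumes "z \<noteq> 1"
  shows "z / (1 - z) ^ 2 = (((1 + z) / (1 - z)) ^ 2 - 1) / 4"
  using assms by (simp add: power_divide divide_simps) algebra

lemma koebe_function_real:
  fixes z :: complex
  assumes "norm z < 1" "z / (1 - z) ^ 2 = of_real x"
  shows "x > - 1 / 4"
proof -
  have "z \<noteq> 1" using assms(1) by auto
  have "((1 + z) / (1 - z)) ^ 2 = 4 * (z / (1 - z) ^ 2) + 1"
    unfolding koebe_function_cayley[OF \<open>z \<noteq> 1\<close>] by (simp add: diff_divide_distrib)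
  then have "((1 + z) / (1 - z)) ^ 2 = of_real (4 * x + 1)"
    by (simp add: assms(2))
  from half_plane_square_real[OF Re_cayley_pos[OF assms(1)] this] show ?thesis
    by simp
qed

text \<open>Off the slit the principal root of 4 v + 1 has positive real part, and its inverse
  Cayley transform is the required z.\<close>

lemma koebe_function_surj:
  fixes v :: complex
  assumes "4 * v + 1 \<notin> \<real>\<^sub>\<le>\<^sub>0"
  shows "\<exists>z. norm z < 1 \<and> z / (1 - z) ^ 2 = v"
proof -
  define \<zeta> where "\<zeta> = csqrt (4 * v + 1)"
  have sq: "\<zeta> ^ 2 = 4 * v + 1" by (simp add: \<zeta>_def)
  have "Re \<zeta> \<noteq> 0"
  proof
    assume "Re \<zeta> = 0"
    then have "\<zeta> ^ 2 \<in> \<real>\<^sub>\<le>\<^sub>0"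
      by (simp add: complex_nonpos_Reals_iff power2_eq_square)
    with assms sq show False by simp
  qed
  then have Re: "Re \<zeta> > 0"
    using Re_csqrt[of "4 * v + 1"] unfolding \<zeta>_def by linarith
  then have nz: "\<zeta> + 1 \<noteq> 0" by (auto simp: complex_eq_iff)
  define z where "z = (\<zeta> - 1) / (\<zeta> + 1)"
  have "norm z < 1"
    unfolding z_def by (rule norm_inverse_cayley_less_1[OF Re])
  moreover have "(1 + z) / (1 - z) = \<zeta>"
  proof -
    have "1 + z = 2 * \<zeta> / (\<zeta> + 1)" "1 - z = 2 / (\<zeta> + 1)"
      using nz by (simp_all add: z_def field_simps)
    then show ?thesis using nz by simp
  qed
  moreover from \<open>norm z < 1\<close> have "z \<noteq> 1" by auto
  ultimately show ?thesis
    using koebe_function_cayley[of z] sq by auto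
qed

text \<open>With \<open>k = 4 \<rho> / (1 + \<rho>)\<^sup>2\<close>, \<open>\<zeta> = (1 + z) / (1 - z)\<close> and \<open>s = (1 + w) / (1 - w)\<close> the Pick equation
  reads \<open>s\<^sup>2 = k \<zeta>\<^sup>2 + 1 - k\<close>, and \<open>s\<close> is \<open>pick_root k z / (1 - z)\<close>; clearing the denominator in this
  way makes the root analytic at \<open>1\<close>.\<close>
definition pick_root :: "real \<Rightarrow> complex \<Rightarrow> complex" where
  "pick_root k z = csqrt (1 + z ^ 2 + 2 * of_real (2 * k - 1) * z)"

text \<open>The inverse Cayley transform (s - 1) / (s + 1) with numerator and denominator multiplied
  by 1 - z.\<close>

definition pick_map :: "real \<Rightarrow> complex \<Rightarrow> complex" where
  "pick_map k z = (pick_root k z - (1 - z)) / (pick_root k z + (1 - z))"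

text \<open>This makes the principal root holomorphic. Put b = 2 k - 1, so |b| < 1. A real z gives
  (z + b)^2 + 1 - b^2 > 0; a nonreal z with real radicand has Re z = -b, and the radicand is then 1
  - |z|^2 > 0.\<close>

lemma pick_radicand:
  fixes z :: complex
  assumes k: "0 < k" "k < 1" and z: "norm z < 1"
  shows "1 + z ^ 2 + 2 * of_real (2 * k - 1) * z \<notin> \<real>\<^sub>\<le>\<^sub>0"
proof
  define b where "b = 2 * k - 1"
  have b: "b\<^sup>2 < 1"
    using k by (simp add: b_def abs_square_less_1 abs_less_iff)
  obtain x y where xy: "z = Complex x y" by (cases z)
  have "norm z ^ 2 < 1"
    using z by (simp add: abs_square_less_1)
  then have less: "x\<^sup>2 + y\<^sup>2 < 1"
    by (simp add: xy cmod_power2)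
  assume "1 + z ^ 2 + 2 * of_real (2 * k - 1) * z \<in> \<real>\<^sub>\<le>\<^sub>0"
  then have re: "1 + x\<^sup>2 - y\<^sup>2 + 2 * b * x \<le> 0" and im: "2 * y * (x + b) = 0"
    unfolding b_def[symmetric] complex_nonpos_Reals_iff xy
    by (simp_all add: power2_eq_square algebra_simps)
  show False
  proof (cases "y = 0")
    case True
    then have "(x + b)\<^sup>2 + (1 - b\<^sup>2) \<le> 0"
      using re by (simp add: power2_eq_square algebra_simps)
    with b show False
      using zero_le_power2[of "x + b"] by linarith
  next
    case False
    with im have "b = - x" by simp
    with re less show False by (simp add: power2_eq_square)
  qed
qed

lemma pick_root_holomorphic:
  assumes "0 < k" "k < 1"
  shows "pick_root k holomorphic_on ball 0 1"
  unfolding pick_root_def using pick_radicand[OF assms]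
  by (intro holomorphic_intros) auto

lemma pick_root_quotient:
  assumes k: "0 < k" "k < 1" and z: "norm z < 1"
  shows "(pick_root k z / (1 - z)) ^ 2 = of_real k * ((1 + z) / (1 - z)) ^ 2 + of_real (1 - k)"
proof -
  have "z \<noteq> 1" using z by auto
  then show ?thesis
    by (simp add: pick_root_def power_divide divide_simps) (simp add: power2_eq_square algebra_simps)
qed

text \<open>A continuity argument: the quotient equals 1 at z = 0, and its real part never vanishes.
  An imaginary quotient would make the square of (1 + z) / (1 - z) negative, which is impossible in
  the right half-plane.\<close>

lemma pick_root_quotient_Re_pos:
  assumes k: "0 < k" "k < 1" and z: "norm z < 1"
  shows "Re (pick_root k z / (1 - z)) > 0"
proof (rule ccontr)
  define h where "h = (\<lambda>z. Re (pick_root k z / (1 - z)))"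
  have nz: "h z \<noteq> 0" if "norm z < 1" for z
  proof
    define s where "s = pick_root k z / (1 - z)"
    assume "h z = 0"
    then have s_eq: "s = \<i> * of_real (Im s)"
      by (simp add: complex_eq_iff h_def s_def)
    have "s ^ 2 = (\<i> * of_real (Im s)) ^ 2"
      by (rule arg_cong[OF s_eq])
    then have "s ^ 2 = of_real (- (Im s)\<^sup>2)"
      by (simp add: power_mult_distrib)
    then have "of_real k * ((1 + z) / (1 - z)) ^ 2 = of_real (- (Im s)\<^sup>2 - (1 - k))"
      using pick_root_quotient[OF k that] unfolding s_def[symmetric]
      by (simp add: algebra_simps)
    then have "((1 + z) / (1 - z)) ^ 2 = of_real ((- (Im s)\<^sup>2 - (1 - k)) / k)"
      using k(1) by (simp add: field_simps)
    from half_plane_square_real[OF Re_cayley_pos[OF that] this]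
    have "- (Im s)\<^sup>2 - (1 - k) > 0"
      using k by (simp add: zero_less_divide_iff)
    with k zero_le_power2[of "Im s"] show False by linarith
  qed
  assume "\<not> Re (pick_root k z / (1 - z)) > 0"
  then have "h z \<le> 0" by (simp add: h_def)
  have "continuous_on (ball 0 1) h"
    unfolding h_def
    by (intro continuous_intros holomorphic_on_imp_continuous_on pick_root_holomorphic k) auto
  then have "connected (h ` ball 0 1)"
    by (rule connected_continuous_image) simp
  moreover have "h 0 = 1"
    by (simp add: h_def pick_root_def)
  ultimately have "0 \<in> h ` ball 0 1"
    using z \<open>h z \<le> 0\<close>
    by (intro connectedD_interval[of _ "h z" "h 0" 0]) auto
  with nz show False by auto
qed

lemma pick_map_eq_cayley:
  assumes "norm z < 1"
  shows "pick_map k z = (pick_root k z / (1 - z) - 1) / (pick_root k z / (1 - z) + 1)"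
proof -
  have "1 - z \<noteq> 0" using assms by auto
  moreover from this have "pick_root k z / (1 - z) - 1 = (pick_root k z - (1 - z)) / (1 - z)"
    "pick_root k z / (1 - z) + 1 = (pick_root k z + (1 - z)) / (1 - z)"
    by (simp_all add: diff_divide_distrib add_divide_distrib)
  ultimately show ?thesis
    by (simp add: pick_map_def)
qed

lemma pick_map_norm_less_1:
  assumes "0 < k" "k < 1" "norm z < 1"
  shows "norm (pick_map k z) < 1"
  unfolding pick_map_eq_cayley[OF assms(3)]
  by (rule norm_inverse_cayley_less_1[OF pick_root_quotient_Re_pos[OF assms]])

lemma pick_map_equation:
  assumes k: "0 < k" "k < 1" and z: "norm z < 1"
  shows "pick_map k z / (1 - pick_map k z) ^ 2 = of_real k * (z / (1 - z) ^ 2)"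
proof -
  define s where "s = pick_root k z / (1 - z)"
  have "Re s > 0"
    unfolding s_def using assms by (rule pick_root_quotient_Re_pos)
  then have nz: "s + 1 \<noteq> 0" by (auto simp: complex_eq_iff)
  have w: "pick_map k z = (s - 1) / (s + 1)"
    unfolding s_def by (rule pick_map_eq_cayley[OF z])
  have one_minus_w: "1 - pick_map k z = 2 / (s + 1)"
    unfolding w using nz by (simp add: field_simps)
  have "pick_map k z / (1 - pick_map k z) ^ 2 = (s - 1) / (s + 1) / (2 / (s + 1)) ^ 2"
    unfolding one_minus_w by (simp only: w)
  also have "\<dots> = (s ^ 2 - 1) / 4"
    using nz by (simp add: power2_eq_square divide_simps) (simp add: algebra_simps)
  also have "\<dots> = of_real k * ((((1 + z) / (1 - z)) ^ 2 - 1) / 4)"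
    unfolding s_def pick_root_quotient[OF assms] by (simp add: field_simps)
  also have "(((1 + z) / (1 - z)) ^ 2 - 1) / 4 = z / (1 - z) ^ 2"
    by (rule koebe_function_cayley[symmetric]) (use z in auto)
  finally show ?thesis .
qed

lemma pick_map_unique:
  assumes k: "0 < k" "k < 1" and z: "norm z < 1" and w: "norm w < 1"
    and eq: "w / (1 - w) ^ 2 = of_real k * (z / (1 - z) ^ 2)"
  shows "w = pick_map k z"
  using koebe_function_inj[of 1 w "pick_map k z"] w pick_map_norm_less_1[OF k z] eq
    pick_map_equation[OF k z] by simp

section \<open>Univalence and image of the Pick map\<close>

lemma pick_map_holomorphic:
  assumes k: "0 < k" "k < 1"
  shows "pick_map k holomorphic_on ball 0 1"
proof -
  have "pick_root k z + (1 - z) \<noteq> 0" if "z \<in> ball 0 1" for z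
  proof
    assume "pick_root k z + (1 - z) = 0"
    then have "pick_root k z = - (1 - z)" by (simp add: add_eq_0_iff2)
    moreover have "1 - z \<noteq> 0" using that by auto
    ultimately have "pick_root k z / (1 - z) = - 1"
      by (metis divide_minus_left divide_self)
    then show False
      using pick_root_quotient_Re_pos[OF k, of z] that by simp
  qed
  then show ?thesis
    unfolding pick_map_def by (intro holomorphic_intros pick_root_holomorphic k) auto
qed

lemma pick_map_inj:
  assumes k: "0 < k" "k < 1"
  shows "inj_on (pick_map k) (ball 0 1)"
proof (rule inj_onI)
  fix z1 z2 :: complex
  assume z: "z1 \<in> ball 0 1" "z2 \<in> ball 0 1" and eq: "pick_map k z1 = pick_map k z2"
  have "of_real k * (z1 / (1 - z1) ^ 2) = of_real k * (z2 / (1 - z2) ^ 2)"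
    using pick_map_equation[OF k, of z1] pick_map_equation[OF k, of z2] z eq by simp
  then have "z1 / (1 - 1 * z1) ^ 2 = z2 / (1 - 1 * z2) ^ 2"
    using k by (subst (asm) mult_left_cancel) auto
  then show "z1 = z2"
    using z by (intro koebe_function_inj[of 1 z1 z2]) auto
qed

text \<open>The Koebe function maps the disk onto the plane without the ray from -1/4 to the left,
  and multiplication by k moves the tip to -k/4. The disk points whose Koebe values lie on the
  longer ray are the -x with \<rho> \<le> x < 1, since k/4 is the value of x / (1 + x)^2 at \<rho>
  and this function increases up to x = 1.\<close>

lemma pick_map_image:
  assumes \<rho>: "0 < \<rho>" "\<rho> < 1"
  defines "k \<equiv> 4 * \<rho> / (1 + \<rho>) ^ 2"
  assumes k: "0 < k" "k < 1"
  shows "pick_map k ` ball 0 1 = ball 0 1 - closed_segment (- 1) (- of_real \<rho>)"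
proof -
  have seg: "closed_segment (- 1) (- complex_of_real \<rho>) = (\<lambda>x. - of_real x) ` {\<rho>..1}"
  proof -
    have "closed_segment (- 1) (- complex_of_real \<rho>) = of_real ` closed_segment (- 1) (- \<rho>)"
      using closed_segment_of_real[of "- 1" "- \<rho>", where ?'a = complex] by simp
    also have "closed_segment (- 1) (- \<rho>) = uminus ` {\<rho>..1}"
      using \<rho> by (simp add: closed_segment_eq_real_ivl)
    finally show ?thesis by (simp only: image_image of_real_minus)
  qed
  have neg: "(- complex_of_real x) / (1 - (- complex_of_real x)) ^ 2 = of_real (- x / (1 + x) ^ 2)" for x
    by simp
  show ?thesis
  proof (intro equalityI subsetI)
    fix w :: complex assume "w \<in> pick_map k ` ball 0 1"
    then obtain z where z: "norm z < 1" "w = pick_map k z" by auto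
    have w: "norm w < 1" using z pick_map_norm_less_1[OF k] by simp
    have "w \<notin> closed_segment (- 1) (- of_real \<rho>)"
    proof
      assume "w \<in> closed_segment (- 1) (- of_real \<rho>)"
      then obtain x where x: "\<rho> \<le> x" "x \<le> 1" "w = - of_real x"
        unfolding seg by auto
      with w \<rho> have "x < 1" by simp
      have "of_real k * (z / (1 - z) ^ 2) = of_real (- x / (1 + x) ^ 2)"
        using pick_map_equation[OF k z(1)] neg[of x] x(3) z(2) by simp
      then have "z / (1 - z) ^ 2 = of_real (- x / (1 + x) ^ 2) / of_real k"
        using k by (metis less_irrefl nonzero_mult_div_cancel_left of_real_eq_0_iff)
      then have "z / (1 - z) ^ 2 = of_real (- x / (1 + x) ^ 2 / k)"
        by (simp only: of_real_divide)
      from koebe_function_real[OF z(1) this] have "- (x / (1 + x) ^ 2) / k > - 1 / 4"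
        by simp
      then have "x / (1 + x) ^ 2 < k / 4"
        using k(1) by (simp only: pos_less_divide_eq)
      also have "k / 4 = \<rho> / (1 + \<rho>) ^ 2"
        by (simp add: k_def)
      finally have "x / (1 + x) ^ 2 < \<rho> / (1 + \<rho>) ^ 2" .
      then have "x * (1 + \<rho>) ^ 2 < \<rho> * (1 + x) ^ 2"
        using x \<rho> by (simp add: divide_simps split: if_splits)
      moreover have "x * (1 + \<rho>) ^ 2 - \<rho> * (1 + x) ^ 2 = (x - \<rho>) * (1 - x * \<rho>)"
        by algebra
      moreover have "x * \<rho> \<le> 1"
        using x \<rho> by (intro mult_le_one) auto
      then have "(x - \<rho>) * (1 - x * \<rho>) \<ge> 0"
        using x by (intro mult_nonneg_nonneg) auto
      ultimately show False by linarith
    qed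
    with w show "w \<in> ball 0 1 - closed_segment (- 1) (- of_real \<rho>)" by simp
  next
    fix w :: complex assume "w \<in> ball 0 1 - closed_segment (- 1) (- of_real \<rho>)"
    then have w: "norm w < 1" and nseg: "w \<notin> closed_segment (- 1) (- of_real \<rho>)" by auto
    define v where "v = w / (1 - w) ^ 2 / of_real k"
    have wv: "w / (1 - w) ^ 2 = of_real k * v"
      using k by (simp add: v_def)
    have "4 * v + 1 \<notin> \<real>\<^sub>\<le>\<^sub>0"
    proof
      assume "4 * v + 1 \<in> \<real>\<^sub>\<le>\<^sub>0"
      then obtain u where u: "4 * v + 1 = of_real u" "u \<le> 0"
        by (auto elim: nonpos_Reals_cases)
      define y where "y = k * (1 - u) / 4"
      have "v = of_real ((u - 1) / 4)"
        using u(1) by (simp add: field_simps eq_diff_eq)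
      then have "w / (1 - w) ^ 2 = of_real (k * ((u - 1) / 4))"
        unfolding wv by (simp only: of_real_mult)
      also have "k * ((u - 1) / 4) = - y"
        by (simp add: y_def field_simps)
      finally have wy: "w / (1 - w) ^ 2 = of_real (- y)" .
      have "\<rho> / (1 + \<rho>) ^ 2 \<le> y"
      proof -
        have "\<rho> / (1 + \<rho>) ^ 2 = k / 4"
          by (simp add: k_def)
        moreover have "k * u \<le> 0"
          using k u(2) by (intro mult_nonneg_nonpos) auto
        ultimately show ?thesis
          by (simp add: y_def right_diff_distrib)
      qed
      moreover have "y < 1 / 4"
        using koebe_function_real[OF w wy] by simp
      moreover have "continuous_on {\<rho>..1} (\<lambda>x. x / (1 + x) ^ 2)"
        using \<rho> by (intro continuous_intros) auto
      \<comment> \<open>The intermediate value theorem finds a point -x of the segment with the same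
        Koebe value as w; injectivity then identifies it with w.\<close>
      ultimately obtain x where x: "\<rho> \<le> x" "x \<le> 1" "x / (1 + x) ^ 2 = y"
        using IVT'[of "\<lambda>x. x / (1 + x) ^ 2" \<rho> y 1] \<rho> by auto
      then have "x < 1"
        using \<open>y < 1 / 4\<close> by (cases "x = 1") auto
      have "w / (1 - 1 * w) ^ 2 = (- of_real x) / (1 - 1 * (- of_real x)) ^ 2"
        using wy neg[of x] x(3) by simp
      then have "w = - of_real x"
        using w \<rho> x \<open>x < 1\<close> by (intro koebe_function_inj[of 1 w "- of_real x"]) auto
      with x nseg show False unfolding seg by auto
    qed
    from koebe_function_surj[OF this] obtain z where z: "norm z < 1" "z / (1 - z) ^ 2 = v"
      by blast
    have "w = pick_map k z"
      using z wv by (intro pick_map_unique k w) simp_all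
    with z show "w \<in> pick_map k ` ball 0 1" by auto
  qed
qed

text \<open>With s = z - 1 and g the root, the map minus 1 is 2 s / (g - s). Inserting g = 2 K + K s
  + E s^2 and comparing powers of s determines the three coefficients.\<close>

lemma pick_map_expansion:
  assumes \<kappa>: "0 < \<kappa>" "\<kappa> < 1"
  defines "K \<equiv> complex_of_real \<kappa>"
  defines "a1 \<equiv> 1 / K" and "a2 \<equiv> (1 - K) / (2 * K ^ 2)"
    and "a3 \<equiv> ((1 - K) ^ 2 / (2 * K ^ 2) - (1 - K ^ 2) / (4 * K ^ 2)) / (2 * K)"
  shows "((\<lambda>z. (pick_map (\<kappa> ^ 2) z - (1 + a1 * (z - 1) + a2 * (z - 1) ^ 2 + a3 * (z - 1) ^ 3))
            / (z - 1) ^ 3) \<longlongrightarrow> 0) (at 1)"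
proof -
  have K: "K \<noteq> 0" using \<kappa> by (simp add: K_def)
  define g where "g = pick_root (\<kappa> ^ 2)"
  have g_sq: "g z ^ 2 = 1 + z ^ 2 + 2 * (2 * K ^ 2 - 1) * z" for z
    by (simp add: g_def pick_root_def K_def)
  have g1: "g 1 = 2 * K"
  proof -
    have "1 + 1 ^ 2 + 2 * complex_of_real (2 * \<kappa> ^ 2 - 1) * 1 = (2 * K) ^ 2"
      by (simp add: K_def power2_eq_square)
    moreover have "csqrt ((2 * K) ^ 2) = 2 * K"
      using \<kappa> by (intro csqrt_square) (simp add: K_def)
    ultimately show ?thesis by (simp only: g_def pick_root_def)
  qed
  have g: "(g \<longlongrightarrow> 2 * K) (at 1)"
  proof -
    have "1 + 1 ^ 2 + 2 * complex_of_real (2 * \<kappa> ^ 2 - 1) * 1 \<notin> \<real>\<^sub>\<le>\<^sub>0"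
      using \<kappa> by (simp add: complex_nonpos_Reals_iff)
    then have "isCont (csqrt \<circ> (\<lambda>z. 1 + z ^ 2 + 2 * complex_of_real (2 * \<kappa> ^ 2 - 1) * z)) 1"
      by (intro continuous_at_compose continuous_at_csqrt continuous_intros)
    then show ?thesis
      unfolding continuous_at o_def pick_root_def[symmetric] g_def[symmetric] g1 .
  qed
  \<comment> \<open>The radicand is (2 K + K s)^2 + (1 - K^2) s^2, so \<open>E\<close> is the exact
    second-order quotient of the root, obtained by rationalising the difference.\<close>
  define E where "E = (\<lambda>z. (1 - K ^ 2) / (g z + 2 * K + K * (z - 1)))"
  have s0: "((\<lambda>z::complex. z - 1) \<longlongrightarrow> 0) (at 1)"
    by (rule LIM_zero) (rule tendsto_ident_at)
  have den: "((\<lambda>z. g z + 2 * K + K * (z - 1)) \<longlongrightarrow> 4 * K) (at 1)"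
    using tendsto_add[OF tendsto_add[OF g tendsto_const[of "2 * K"]] tendsto_mult[OF tendsto_const[of K] s0]]
    by simp
  have gs: "((\<lambda>z. g z - (z - 1)) \<longlongrightarrow> 2 * K) (at 1)"
    using tendsto_diff[OF g s0] by simp
  have E: "(E \<longlongrightarrow> (1 - K ^ 2) / (4 * K)) (at 1)"
    unfolding E_def using K by (intro tendsto_divide tendsto_const den) simp
  \<comment> \<open>This is what remains of the product of the cubic polynomial and g - s after the
    powers s and s^2 cancel. The value of a3 is the one that makes it vanish at s = 0.\<close>
  define R where "R = (\<lambda>s e. a1 * e + a2 * (K - 1) + 2 * K * a3 + s * (a2 * e + a3 * (K - 1)) + a3 * e * s ^ 2)"
  have "((\<lambda>z. - R (z - 1) (E z) / (g z - (z - 1))) \<longlongrightarrow> - R 0 ((1 - K ^ 2) / (4 * K)) / (2 * K)) (at 1)"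
    unfolding R_def using K by (intro tendsto_intros E s0 gs) auto
  moreover have "R 0 ((1 - K ^ 2) / (4 * K)) = 0"
    unfolding R_def a1_def a2_def a3_def using K
    by (simp add: field_simps power2_eq_square)
  ultimately have "((\<lambda>z. - R (z - 1) (E z) / (g z - (z - 1))) \<longlongrightarrow> 0) (at 1)" by simp
  moreover have "\<forall>\<^sub>F z in at 1. - R (z - 1) (E z) / (g z - (z - 1)) =
      (pick_map (\<kappa> ^ 2) z - (1 + a1 * (z - 1) + a2 * (z - 1) ^ 2 + a3 * (z - 1) ^ 3)) / (z - 1) ^ 3"
  proof -
    have "\<forall>\<^sub>F z in at 1. g z + 2 * K + K * (z - 1) \<noteq> 0"
      using K by (intro tendsto_imp_eventually_ne[OF den]) simp
    moreover have "\<forall>\<^sub>F z in at 1. g z - (z - 1) \<noteq> 0"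
      using K by (intro tendsto_imp_eventually_ne[OF gs]) simp
    ultimately show ?thesis
      using eventually_neq_at_within[of 1 1 UNIV]
    proof eventually_elim
      case (elim z)
      define s where "s = z - 1"
      have nz: "s \<noteq> 0" "g z - s \<noteq> 0"
        using elim by (auto simp: s_def)
      have "(g z - (2 * K + K * s)) * (g z + 2 * K + K * (z - 1)) = s ^ 2 * (1 - K ^ 2)"
        using g_sq[of z] unfolding s_def by algebra
      then have "g z - (2 * K + K * s) = E z * s ^ 2"
        using elim(1) by (simp add: E_def field_simps)
      then have gz: "g z = 2 * K + K * s + E z * s ^ 2" by (simp add: algebra_simps)
      have c: "K * a1 = 1" "a1 * (K - 1) + 2 * K * a2 = 0"
        using K by (simp_all add: a1_def a2_def field_simps power2_eq_square)
      have "2 * s - (a1 * s + a2 * s ^ 2 + a3 * s ^ 3) * (g z - s) = - R s (E z) * s ^ 3"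
        unfolding gz R_def using c by algebra
      moreover have "pick_map (\<kappa> ^ 2) z - 1 = 2 * s / (g z - s)"
      proof -
        have "pick_map (\<kappa> ^ 2) z = (g z + s) / (g z - s)"
          unfolding pick_map_def g_def[symmetric] by (simp add: s_def algebra_simps)
        then show ?thesis using nz by (simp add: field_simps)
      qed
      then have "(pick_map (\<kappa> ^ 2) z - (1 + a1 * s + a2 * s ^ 2 + a3 * s ^ 3)) * (g z - s) =
          2 * s - (a1 * s + a2 * s ^ 2 + a3 * s ^ 3) * (g z - s)"
        using nz by (simp add: field_simps)
      ultimately have "(pick_map (\<kappa> ^ 2) z - (1 + a1 * s + a2 * s ^ 2 + a3 * s ^ 3)) * (g z - s) =
          - R s (E z) * s ^ 3" by simp
      then show ?case
        unfolding s_def[symmetric] using nz by (subst frac_eq_eq) auto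
    qed
  qed
  ultimately show ?thesis
    by (rule Lim_transform_eventually)
qed

text \<open>The Pick function is known only inside the disk, whereas the limit is computed for
  \<open>pick_map\<close> in a full punctured neighbourhood of 1. Stolz angles lie in the disk, so
  the expansion carries over.\<close>

lemma boundary_expansionI:
  assumes lim: "((\<lambda>z. (g z - (1 + a1 * (z - 1) + a2 * (z - 1) ^ 2 + a3 * (z - 1) ^ 3)) / (z - 1) ^ 3)
      \<longlongrightarrow> 0) (at 1)"
    and eq: "\<And>z. z \<in> ball 0 1 \<Longrightarrow> f z = g z"
  shows "boundary_expansion f a1 a2 a3"
  unfolding boundary_expansion_def
proof (intro allI impI)
  fix \<alpha> :: real
  let ?F = "at 1 within stolz_angle \<alpha>"
  let ?p = "\<lambda>z. 1 + a1 * (z - 1) + a2 * (z - 1) ^ 2 + a3 * (z - 1) ^ 3"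
  have small: "(\<lambda>z. g z - ?p z) \<in> o[?F](\<lambda>z. (z - 1) ^ 3)"
  proof (rule smalloI_tendsto)
    show "((\<lambda>z. (g z - ?p z) / (z - 1) ^ 3) \<longlongrightarrow> 0) ?F"
      by (rule tendsto_within_subset[OF lim]) simp
    show "\<forall>\<^sub>F z in ?F. (z - 1) ^ 3 \<noteq> 0"
      by (simp add: eventually_at_filter)
  qed
  have "\<forall>\<^sub>F z in ?F. f z - ?p z = g z - ?p z"
    using eq by (auto simp: eventually_at_filter stolz_angle_def)
  from landau_o.small.in_cong[OF this] small
  show "(\<lambda>z. f z - ?p z) \<in> o[?F](\<lambda>z. (z - 1) ^ 3)"
    by (rule iffD2)
qed

theorem theorem4p8:
  "(\<forall>f w0. f \<in> class_B \<and> inj_on f (ball 0 1) \<and> w0 \<in> ball 0 1 \<and> w0 \<notin> f ` ball 0 1 \<longrightarrow>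
      Re (boundary_schwarzian f / (boundary_deriv f) ^ 2)
        \<le> - (3 / 4) * ((1 - norm w0) / (1 + norm w0)) ^ 2) \<and>
   (\<forall>\<rho>::real. 0 < \<rho> \<and> \<rho> < 1 \<longrightarrow>
      (\<forall>z \<in> ball 0 1. \<exists>!w. w \<in> ball 0 1 \<and> pick_equation \<rho> z w) \<and>
      pick_function \<rho> \<in> class_B \<and>
      inj_on (pick_function \<rho>) (ball 0 1) \<and>
      (\<forall>z \<in> ball 0 1. deriv (pick_function \<rho>) z \<noteq> 0) \<and>
      pick_function \<rho> ` ball 0 1 = ball 0 1 - closed_segment (- 1) (- of_real \<rho>) \<and>
      Re (boundary_schwarzian (pick_function \<rho>) / (boundary_deriv (pick_function \<rho>)) ^ 2)
        = - (3 / 4) * ((1 - \<rho>) / (1 + \<rho>)) ^ 2)"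
proof (intro conjI[of "All P" for P] allI impI)
  fix f w0
  assume "f \<in> class_B \<and> inj_on f (ball 0 1) \<and> w0 \<in> ball 0 1 \<and> w0 \<notin> f ` ball 0 1"
  then obtain A :: real and a2 a3 where f: "f holomorphic_on ball 0 1" "inj_on f (ball 0 1)"
    "f ` ball 0 1 \<subseteq> ball 0 1" and ex: "boundary_expansion f (of_real A) a2 a3"
    and A: "A > 0" "Re (2 * a2 + of_real A * (1 - of_real A)) = 0"
    and w0: "w0 \<in> ball 0 1" "w0 \<notin> f ` ball 0 1"
    unfolding class_B_def by blast
  have "boundary_schwarzian f / (boundary_deriv f) ^ 2 =
      6 * (a3 / of_real A - a2 ^ 2 / of_real A ^ 2) / of_real A ^ 2"
    by (simp add: boundary_schwarzian_def boundary_deriv_def boundary_coeffs_eq[OF ex])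
  then show "Re (boundary_schwarzian f / (boundary_deriv f) ^ 2)
      \<le> - (3 / 4) * ((1 - norm w0) / (1 + norm w0)) ^ 2"
    using schwarzian_bound[OF f ex A w0] by simp
next
  fix \<rho> :: real
  assume "0 < \<rho> \<and> \<rho> < 1"
  then have \<rho>: "0 < \<rho>" "\<rho> < 1" by auto
  define k where "k = 4 * \<rho> / (1 + \<rho>) ^ 2"
  have one_minus_k: "1 - k = ((1 - \<rho>) / (1 + \<rho>)) ^ 2"
    using \<rho> by (simp add: k_def power_divide divide_simps) (simp add: power2_eq_square algebra_simps)
  have "((1 - \<rho>) / (1 + \<rho>)) ^ 2 > 0"
    using \<rho> by simp
  with one_minus_k have "k < 1" by linarith
  moreover have "0 < k"
    using \<rho> by (simp add: k_def)
  ultimately have k: "0 < k" "k < 1" by simp_all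
  \<comment> \<open>The root takes the value 2 \<kappa> at 1, so the boundary coefficients are
    rational in \<kappa>; the boundary derivative is 1 / \<kappa>.\<close>
  define \<kappa> where "\<kappa> = sqrt k"
  have \<kappa>: "0 < \<kappa>" "\<kappa> < 1" "\<kappa> ^ 2 = k"
    using k by (simp_all add: \<kappa>_def)
  have equation: "pick_equation \<rho> z w \<longleftrightarrow> w / (1 - w) ^ 2 = of_real k * (z / (1 - z) ^ 2)" for z w
    by (auto simp: pick_equation_def k_def mult_ac)
  have sol: "w \<in> ball 0 1 \<and> pick_equation \<rho> z w \<longleftrightarrow> w = pick_map k z" if "z \<in> ball 0 1" for z w
    using that pick_map_unique[OF k, of z w] pick_map_norm_less_1[OF k, of z] pick_map_equation[OF k, of z]
    unfolding equation by auto
  have eq: "pick_function \<rho> z = pick_map k z" if "z \<in> ball 0 1" for z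
    unfolding pick_function_def sol[OF that] by simp
  have hol: "pick_function \<rho> holomorphic_on ball 0 1"
    by (rule holomorphic_transform[OF pick_map_holomorphic[OF k]]) (simp add: eq)
  have inj: "inj_on (pick_function \<rho>) (ball 0 1)"
    using pick_map_inj[OF k] eq inj_on_cong by blast
  have image: "pick_function \<rho> ` ball 0 1 = ball 0 1 - closed_segment (- 1) (- of_real \<rho>)"
    using pick_map_image[OF \<rho>] k eq unfolding k_def[symmetric] by (metis image_cong)
  define K where "K = complex_of_real \<kappa>"
  define a1 a2 a3 where "a1 = 1 / \<kappa>" and "a2 = (1 - K) / (2 * K ^ 2)"
    and "a3 = ((1 - K) ^ 2 / (2 * K ^ 2) - (1 - K ^ 2) / (4 * K ^ 2)) / (2 * K)"
  have K: "K \<noteq> 0" using \<kappa> by (simp add: K_def)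
  have a1: "of_real a1 = 1 / K" by (simp add: a1_def K_def)
  have ex: "boundary_expansion (pick_function \<rho>) (of_real a1) a2 a3"
    using pick_map_expansion[OF \<kappa>(1,2)] eq
    unfolding \<kappa>(3) K_def[symmetric] a1[symmetric] a2_def[symmetric] a3_def[symmetric]
    by (rule boundary_expansionI)
  have "pick_function \<rho> \<in> class_B"
  proof -
    have "2 * a2 + of_real a1 * (1 - of_real a1) = 0"
      unfolding a1 a2_def using K by (simp add: field_simps power2_eq_square)
    then have "Re (2 * a2 + of_real a1 * (1 - of_real a1)) = 0" by simp
    moreover have "a1 > 0" using \<kappa> by (simp add: a1_def)
    moreover have "pick_function \<rho> ` ball 0 1 \<subseteq> ball 0 1"
      unfolding image by blast
    ultimately show ?thesis
      unfolding class_B_def using hol ex by blast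
  qed
  moreover have "\<forall>z \<in> ball 0 1. deriv (pick_function \<rho>) z \<noteq> 0"
    using holomorphic_injective_imp_regular[OF hol open_ball inj] by blast
  moreover have "Re (boundary_schwarzian (pick_function \<rho>) / (boundary_deriv (pick_function \<rho>)) ^ 2)
        = - (3 / 4) * ((1 - \<rho>) / (1 + \<rho>)) ^ 2"
  proof -
    have "boundary_schwarzian (pick_function \<rho>) / (boundary_deriv (pick_function \<rho>)) ^ 2 =
        6 * (a3 / (1 / K) - a2 ^ 2 / (1 / K) ^ 2) / (1 / K) ^ 2"
      by (simp add: boundary_schwarzian_def boundary_deriv_def boundary_coeffs_eq[OF ex] a1)
    also have "\<dots> = - (3 / 4) * (1 - K ^ 2)"
      unfolding a2_def a3_def using K by (simp add: field_simps power2_eq_square)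
    also have "\<dots> = of_real (- (3 / 4) * (1 - k))"
      by (simp add: K_def flip: \<kappa>(3))
    finally show ?thesis
      by (simp only: Re_complex_of_real one_minus_k)
  qed
  moreover have "\<forall>z \<in> ball 0 1. \<exists>!w. w \<in> ball 0 1 \<and> pick_equation \<rho> z w"
    using sol by auto
  ultimately show "(\<forall>z \<in> ball 0 1. \<exists>!w. w \<in> ball 0 1 \<and> pick_equation \<rho> z w) \<and>
      pick_function \<rho> \<in> class_B \<and>
      inj_on (pick_function \<rho>) (ball 0 1) \<and>
      (\<forall>z \<in> ball 0 1. deriv (pick_function \<rho>) z \<noteq> 0) \<and>
      pick_function \<rho> ` ball 0 1 = ball 0 1 - closed_segment (- 1) (- of_real \<rho>) \<and>
      Re (boundary_schwarzian (pick_function \<rho>) / (boundary_deriv (pick_function \<rho>)) ^ 2)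
        = - (3 / 4) * ((1 - \<rho>) / (1 + \<rho>)) ^ 2"
    using inj image by blast
qed

end
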